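(* For any integers $r \geq 3$, even $\omega \geq r$, and $d \geq \frac{3}{2}\omega$, there exists a non-trivial snark $G$ with $r(G)=r$, $\omega(G)=\omega$ and $\mu_3(G) \geq d$.
   Context: Graphs are finite, loopless and without parallel edges. A snark is a bridgeless cubic graph whose edges cannot be properly coloured with three colours (i.e. which is not 3-edge-colourable). A snark is called trivial if its girth is less than $5$ or its cyclic connectivity is less than $4$, and non-trivial otherwise; that is, a non-trivial snark has girth at least $5$ and is cyclically $4$-edge-connected (no set of fewer than $4$ edges can be removed so that at least two of the resulting components contain cycles). For a bridgeless cubic graph $G$: - The resistance $r(G)$ is the minimum number of edges which can be removed from $G$ so that the resulting graph is 3-edge-colourable. - The oddness $\omega(G)$ is the minimum number of odd components (cycles of odd length) in a 2-factor of $G$, taken over all 2-factors of $G$. - The colouring defect $\mu_3(G)$ is the minimum, over all choices of three perfect matchings $M_1,M_2,M_3$ of $G$ (not necessarily distinct), of the number of edges of $G$ not contained in $M_1\cup M_2\cup M_3$. *)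

theory Defs
  imports Complex_Main "HOL-Library.Extended_Nat"
begin

text \<open>
  A graph is given by its vertex set \<open>V\<close> and its set \<open>E\<close> of edges, an edge being the
  two-element set of its ends. This representation excludes loops and parallel edges.
\<close>

definition finite_graph :: "'a set \<Rightarrow> 'a set set \<Rightarrow> bool" where
  "finite_graph V E \<longleftrightarrow> finite V \<and> (\<forall>e\<in>E. e \<subseteq> V \<and> card e = 2)"

definition degree :: "'a set set \<Rightarrow> 'a \<Rightarrow> nat" where
  "degree E v = card {e \<in> E. v \<in> e}"

definition cubic :: "'a set \<Rightarrow> 'a set set \<Rightarrow> bool" where
  "cubic V E \<longleftrightarrow> (\<forall>v\<in>V. degree E v = 3)"

definition connected_in :: "'a set \<Rightarrow> 'a set set \<Rightarrow> ('a \<times> 'a) set" where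
  "connected_in V E = {(u, v). u \<in> V \<and> v \<in> V \<and> (u, v) \<in> {(x, y). {x, y} \<in> E}\<^sup>*}"

text \<open>Components are represented by their vertex sets.\<close>

definition components :: "'a set \<Rightarrow> 'a set set \<Rightarrow> 'a set set" where
  "components V E = V // connected_in V E"

definition bridge :: "'a set \<Rightarrow> 'a set set \<Rightarrow> 'a set \<Rightarrow> bool" where
  "bridge V E e \<longleftrightarrow> e \<in> E \<and> card (components V (E - {e})) > card (components V E)"

definition bridgeless :: "'a set \<Rightarrow> 'a set set \<Rightarrow> bool" where
  "bridgeless V E \<longleftrightarrow> (\<forall>e\<in>E. \<not> bridge V E e)"

text \<open>A cycle is given by the list of its vertices in cyclic order, without repeating the first one.\<close>

definition is_cycle :: "'a set \<Rightarrow> 'a set set \<Rightarrow> 'a list \<Rightarrow> bool" where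
  "is_cycle V E p \<longleftrightarrow> length p \<ge> 3 \<and> distinct p \<and> set p \<subseteq> V \<and>
     (\<forall>i<length p. {p ! i, p ! (Suc i mod length p)} \<in> E)"

text \<open>The girth of an acyclic graph is \<open>\<infinity>\<close>.\<close>

definition girth :: "'a set \<Rightarrow> 'a set set \<Rightarrow> enat" where
  "girth V E = (INF p \<in> {p. is_cycle V E p}. enat (length p))"

text \<open>The separating set \<open>S\<close> may be empty, so a graph with two components that
  contain cycles is not cyclically \<open>k\<close>-edge-connected for any \<open>k \<ge> 1\<close>.\<close>

definition cyclically_edge_connected :: "nat \<Rightarrow> 'a set \<Rightarrow> 'a set set \<Rightarrow> bool" where
  "cyclically_edge_connected k V E \<longleftrightarrow>
     \<not> (\<exists>S \<subseteq> E. card S < k \<and>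
          (\<exists>C \<in> components V (E - S). \<exists>D \<in> components V (E - S). C \<noteq> D \<and>
             (\<exists>p. is_cycle V (E - S) p \<and> set p \<subseteq> C) \<and>
             (\<exists>q. is_cycle V (E - S) q \<and> set q \<subseteq> D)))"

definition edge_colourable :: "nat \<Rightarrow> 'a set set \<Rightarrow> bool" where
  "edge_colourable k E \<longleftrightarrow>
     (\<exists>c :: 'a set \<Rightarrow> nat. (\<forall>e\<in>E. c e < k) \<and>
        (\<forall>e\<in>E. \<forall>f\<in>E. e \<noteq> f \<and> e \<inter> f \<noteq> {} \<longrightarrow> c e \<noteq> c f))"

definition snark :: "'a set \<Rightarrow> 'a set set \<Rightarrow> bool" where
  "snark V E \<longleftrightarrow> finite_graph V E \<and> cubic V E \<and> bridgeless V E \<and> \<not> edge_colourable 3 E"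

definition nontrivial_snark :: "'a set \<Rightarrow> 'a set set \<Rightarrow> bool" where
  "nontrivial_snark V E \<longleftrightarrow>
     snark V E \<and> girth V E \<ge> 5 \<and> cyclically_edge_connected 4 V E"

definition perfect_matching :: "'a set \<Rightarrow> 'a set set \<Rightarrow> 'a set set \<Rightarrow> bool" where
  "perfect_matching V E M \<longleftrightarrow> M \<subseteq> E \<and> (\<forall>v\<in>V. degree M v = 1)"

definition two_factor :: "'a set \<Rightarrow> 'a set set \<Rightarrow> 'a set set \<Rightarrow> bool" where
  "two_factor V E F \<longleftrightarrow> F \<subseteq> E \<and> (\<forall>v\<in>V. degree F v = 2)"

text \<open>
  The minima below are over nonempty sets for every bridgeless cubic graph: a set of
  edges whose removal leaves a 3-edge-colourable graph always exists (all of \<open>E\<close>), and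
  perfect matchings and 2-factors exist by Petersen's theorem.
\<close>

definition resistance :: "'a set \<Rightarrow> 'a set set \<Rightarrow> nat" where
  "resistance V E = (LEAST k. \<exists>S \<subseteq> E. card S = k \<and> edge_colourable 3 (E - S))"

text \<open>A component of a 2-factor is a cycle, and its length is its number of vertices.\<close>

definition oddness :: "'a set \<Rightarrow> 'a set set \<Rightarrow> nat" where
  "oddness V E =
     (LEAST k. \<exists>F. two_factor V E F \<and> card {C \<in> components V F. odd (card C)} = k)"

definition colouring_defect :: "'a set \<Rightarrow> 'a set set \<Rightarrow> nat" where
  "colouring_defect V E =
     (LEAST k. \<exists>M1 M2 M3. perfect_matching V E M1 \<and> perfect_matching V E M2 \<and>
        perfect_matching V E M3 \<and> card (E - (M1 \<union> M2 \<union> M3)) = k)"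

end

(*
  Replace edges by vertices: a graph has resistance at most k iff its edges can be 3-coloured with at
  most k defective vertices, and a 2-factor with k odd cycles is a colouring with k defective vertices in
  which every vertex has exactly one edge of colour 0.

  The graph is a ring of 4-poles made from the Petersen graph, closed up by three junctions whose middle
  vertices are joined to a hub. A properly coloured Iso block has equal colours on its two left and on its
  two right dangling edges, a properly coloured Het block has different ones. So every Iso-Het contact, and
  every junction between two Iso blocks, contains a defective vertex; there are r such places and the
  colouring can be chosen to have no other defect.

  A perfect matching contains one spoke only, and the parity of the number of its edges on the two
  rails between consecutive blocks changes at a junction exactly when the spoke there is not in the
  matching. A clean Iso block makes this parity even. Hence, unless one of the two long Iso runs around
  the third junction is entirely defective, the third spoke is in the matching and the parity is odd along
  the first run, all of whose Iso blocks are then defective; their number controls the oddness.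
  For three perfect matchings leaving few edges uncovered, clean Iso blocks exist in the same two long
  runs, so all three are odd on the long Het run; but a clean Het block would carry three different
  matchings on two rails. So the defect grows with the length of the long runs.
*)

theory Submission
  imports Defs "HOL-Library.Nat_Bijection"
begin

section \<open>Parity in finite graphs\<close>

text \<open>Separate parameters tune the invariants. Each of the \<open>t\<close> changes of block
  type forces a defect in every colouring, hence in every 2-factor; three further places raise the
  resistance to \<open>t + 3\<close>. Where a matching is odd on the rails an Iso block has to be
  defective but a Het block does not. So the \<open>p\<close> Iso blocks of the first run raise the
  oddness to \<open>p + t + 1\<close>, while the Het run after them may be of any length without
  changing the oddness and serves only the colouring defect. A colouring whose class 0 is no perfect
  matching is not bound by this parity and avoids the \<open>p\<close> defects, so the resistance
  does not depend on \<open>p\<close>. As the ring has unbounded length, no global property can be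
  decided by enumeration. Finite searches are confined to one block. Their results are combined by a
  potential around the ring for small cuts, by parities along runs for matchings, and by pairwise
  disjoint zones, each containing a defective block, for the lower bounds.\<close>

lemma handshake:
  assumes "finite C" "finite A" "\<And>e. e \<in> A \<Longrightarrow> card e = 2"
    and "\<And>e. e \<in> A \<Longrightarrow> e \<subseteq> C \<or> e \<inter> C = {}"
  shows "(\<Sum>v\<in>C. degree A v) = 2 * card {e \<in> A. e \<subseteq> C}"
proof -
  have "(\<Sum>v\<in>C. degree A v) = (\<Sum>v\<in>C. \<Sum>e\<in>A. of_bool (v \<in> e))"
    using assms(2) by (simp add: degree_def Int_def)
  also have "\<dots> = (\<Sum>e\<in>A. \<Sum>v\<in>C. of_bool (v \<in> e))" by (rule sum.swap)
  also have "\<dots> = (\<Sum>e\<in>A. card (C \<inter> e))" using assms(1) by simp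
  also have "\<dots> = (\<Sum>e\<in>A. 2 * of_bool (e \<subseteq> C))"
  proof (rule sum.cong)
    fix e assume e: "e \<in> A"
    have "e \<noteq> {}" using assms(3)[OF e] by auto
    then show "card (C \<inter> e) = 2 * of_bool (e \<subseteq> C)"
      using assms(3,4)[OF e] by (auto simp: Int_absorb1 Int_commute of_bool_def)
  qed simp
  also have "\<dots> = 2 * card {e \<in> A. e \<subseteq> C}"
    using assms(2) by (simp add: sum_distrib_left[symmetric] Int_def)
  finally show ?thesis .
qed

lemma sym_adj: "sym {(x, y). {x, y} \<in> F}"
  by (auto simp: sym_def insert_commute)

lemma equiv_connected_in: "equiv V (connected_in V F)"
proof (rule equivI)
  show "connected_in V F \<subseteq> V \<times> V" by (auto simp: connected_in_def)
  show "refl_on V (connected_in V F)" by (auto simp: refl_on_def connected_in_def)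
  show "sym (connected_in V F)"
    using sym_rtrancl[OF sym_adj[of F]] by (auto simp: sym_def connected_in_def)
  show "trans (connected_in V F)"
    by (rule transI) (auto simp: connected_in_def intro: rtrancl_trans)
qed

lemma component_subset: "C \<in> components V F \<Longrightarrow> C \<subseteq> V"
  unfolding components_def using in_quotient_imp_subset[OF equiv_connected_in] by blast

lemma components_disjoint:
  "C \<in> components V F \<Longrightarrow> D \<in> components V F \<Longrightarrow> C = D \<or> C \<inter> D = {}"
  unfolding components_def using quotient_disj[OF equiv_connected_in] by blast

lemma component_nonempty: "C \<in> components V F \<Longrightarrow> C \<noteq> {}"
  unfolding components_def using in_quotient_imp_non_empty[OF equiv_connected_in] by blast

lemma component_closed:
  assumes "C \<in> components V F" "{u, v} \<in> F" "u \<in> C" "v \<in> V"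
  shows "v \<in> C"
proof -
  have "(u, v) \<in> connected_in V F"
    using assms component_subset[OF assms(1)] by (auto simp: connected_in_def)
  from in_quotient_imp_closed[OF equiv_connected_in assms(1)[unfolded components_def] assms(3) this]
  show ?thesis .
qed

lemma component_connected:
  assumes "C \<in> components V F" "u \<in> C" "v \<in> C"
  shows "(u, v) \<in> {(x, y). {x, y} \<in> F}\<^sup>*"
  using in_quotient_imp_in_rel[OF equiv_connected_in, of C V F u v] assms
  unfolding components_def by (auto simp: connected_in_def)

lemma ex_component:
  assumes "u \<in> V" obtains C where "C \<in> components V F" "u \<in> C"
proof
  show "connected_in V F `` {u} \<in> components V F"
    unfolding components_def using assms by (rule quotientI)
  show "u \<in> connected_in V F `` {u}" using assms by (auto simp: connected_in_def)
qed

lemma finite_components: "finite V \<Longrightarrow> finite (components V F)"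
  by (meson PowI component_subset finite_Pow_iff rev_finite_subset subsetI)

lemma edge_in_or_out:
  assumes "finite_graph V F" "C \<in> components V F" "e \<in> F"
  shows "e \<subseteq> C \<or> e \<inter> C = {}"
proof -
  obtain a b where ab: "e = {a, b}" "a \<in> V" "b \<in> V"
    using assms(1,3) unfolding finite_graph_def card_2_iff by (metis insert_subset)
  then have "a \<in> C \<longleftrightarrow> b \<in> C"
    using component_closed[OF assms(2)] assms(3) by (metis insert_commute)
  with ab show ?thesis by auto
qed

lemma finite_graph_finite_edges: "finite_graph V F \<Longrightarrow> finite F"
  unfolding finite_graph_def by (meson PowI finite_Pow_iff finite_subset subsetI)

lemma finite_graph_mono: "finite_graph V F \<Longrightarrow> A \<subseteq> F \<Longrightarrow> finite_graph V A"
  unfolding finite_graph_def by blast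

text \<open>Choosing a point of \<open>D\<close> in each \<open>G j\<close> is injective because the
  \<open>G j\<close> are disjoint. The lower bounds for resistance and oddness take for
  \<open>D\<close> the defective blocks and for \<open>G j\<close> disjoint zones of the
  ring.\<close>

lemma card_disjoint_hits_le:
  assumes "finite D" "finite J" "\<And>j. j \<in> J \<Longrightarrow> D \<inter> G j \<noteq> {}"
    and "\<And>i j. i \<in> J \<Longrightarrow> j \<in> J \<Longrightarrow> i \<noteq> j \<Longrightarrow> G i \<inter> G j = {}"
  shows "card J \<le> card D"
proof -
  have "\<forall>j\<in>J. \<exists>x. x \<in> D \<inter> G j" using assms(3) by blast
  then obtain f where f: "\<And>j. j \<in> J \<Longrightarrow> f j \<in> D \<inter> G j" by metis
  have "inj_on f J" by (rule inj_onI) (metis IntD2 assms(4) disjoint_iff f)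
  then show ?thesis
    by (rule card_inj_on_le) (use f assms(1) in auto)
qed

text \<open>A component avoiding \<open>Q\<close> is perfectly matched by \<open>A\<close> and hence
  even, so each odd component uses up a point of \<open>Q\<close> of its own.\<close>

lemma odd_components_le:
  assumes "finite_graph V F" "A \<subseteq> F" "finite Q" "\<And>v. v \<in> V - Q \<Longrightarrow> degree A v = 1"
  shows "card {C \<in> components V F. odd (card C)} \<le> card Q"
proof (rule card_disjoint_hits_le[where G = id])
  have fV: "finite V" using assms(1) by (simp add: finite_graph_def)
  show "finite {C \<in> components V F. odd (card C)}" using finite_components[OF fV] by simp
  fix C assume C: "C \<in> {C \<in> components V F. odd (card C)}"
  show "Q \<inter> id C \<noteq> {}"
  proof
    assume "Q \<inter> id C = {}"
    then have "degree A v = 1" if "v \<in> C" for v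
      using assms(4) component_subset[of C V F] C that by auto
    then have "(\<Sum>v\<in>C. degree A v) = card C" by simp
    moreover have "(\<Sum>v\<in>C. degree A v) = 2 * card {e \<in> A. e \<subseteq> C}"
    proof (rule handshake)
      show "finite C" using finite_subset[OF component_subset fV] C by blast
      show "finite A" using finite_subset[OF assms(2) finite_graph_finite_edges[OF assms(1)]] .
    qed (use assms(1,2) C edge_in_or_out[OF assms(1)] in \<open>auto simp: finite_graph_def\<close>)
    ultimately have "even (card C)" by (metis dvd_triv_left)
    then show False using C by simp
  qed
next
  fix C D assume "C \<in> {C \<in> components V F. odd (card C)}" "D \<in> {C \<in> components V F. odd (card C)}" "C \<noteq> D"
  then show "id C \<inter> id D = {}" using components_disjoint[of C V F D] by simp
qed (rule assms(3))

lemma odd_degree_sym_diff: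
  assumes "finite A" "finite B"
  shows "odd (degree (sym_diff A B) v) \<longleftrightarrow> odd (degree A v) \<noteq> odd (degree B v)"
proof -
  let ?S = "\<lambda>X. {e \<in> X. v \<in> e}"
  have f: "finite (?S A)" "finite (?S B)" using assms by auto
  have "?S (sym_diff A B) = sym_diff (?S A) (?S B)" by auto
  moreover have "card (sym_diff (?S A) (?S B)) = card (?S A - ?S B) + card (?S B - ?S A)"
    using f by (intro card_Un_disjoint) auto
  moreover have "card X = card (X - Y) + card (X \<inter> Y)" if "finite X" for X Y :: "'a set set"
    using that by (subst card_Un_disjoint[symmetric]) (auto intro: arg_cong[of _ _ card])
  from this[OF f(1), of "?S B"] this[OF f(2), of "?S A"]
  have "card (?S A) = card (?S A - ?S B) + card (?S A \<inter> ?S B)"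
    "card (?S B) = card (?S B - ?S A) + card (?S A \<inter> ?S B)" by (simp_all add: Int_commute)
  ultimately show ?thesis unfolding degree_def by auto
qed

lemma degree_single: "degree {e} v = of_bool (v \<in> e)"
proof -
  have "{f \<in> {e}. v \<in> f} = (if v \<in> e then {e} else {})" by auto
  then show ?thesis by (simp add: degree_def)
qed

text \<open>Adding the edges of a walk modulo 2 leaves odd degree only at its two ends, so the walk
  need not be shortened to a path.\<close>

lemma path_join:
  assumes "(u, w) \<in> {(x, y). {x, y} \<in> F}\<^sup>*" "\<And>e. e \<in> F \<Longrightarrow> card e = 2"
  shows "\<exists>A\<subseteq>F. finite A \<and> (\<forall>v. odd (degree A v) \<longleftrightarrow> (v = u) \<noteq> (v = w))"
  using assms(1)
proof (induction rule: rtrancl_induct)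
  case base
  show ?case by (rule exI[of _ "{}"]) (auto simp: degree_def)
next
  case (step y z)
  then obtain A where A: "A \<subseteq> F" "finite A" "\<forall>v. odd (degree A v) \<longleftrightarrow> (v = u) \<noteq> (v = y)"
    by blast
  have "{y, z} \<in> F" using step by auto
  moreover from this have "y \<noteq> z" using assms(2) by fastforce
  ultimately show ?case
    using A by (intro exI[of _ "sym_diff A {{y, z}}"])
      (auto simp: odd_degree_sym_diff degree_single simp del: odd_add)
qed

text \<open>An element of \<open>T\<close> shares its component with a second one, since the number
  there is even. A join of the set without these two is added modulo 2 to a walk between
  them.\<close>

lemma T_join:
  assumes "finite_graph V F" "T \<subseteq> V" "\<And>C. C \<in> components V F \<Longrightarrow> even (card (T \<inter> C))"
  shows "\<exists>A\<subseteq>F. \<forall>v. odd (degree A v) \<longleftrightarrow> v \<in> T"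
proof -
  have "finite T" using assms(1,2) finite_subset by (auto simp: finite_graph_def)
  then show ?thesis using assms(2,3)
  proof (induction "card T" arbitrary: T rule: less_induct)
    case less
    show ?case
    proof (cases "T = {}")
      case True
      then show ?thesis by (intro exI[of _ "{}"]) (auto simp: degree_def)
    next
      case False
      then obtain u where u: "u \<in> T" by blast
      then obtain C where C: "C \<in> components V F" "u \<in> C" using ex_component[of u V F] less.prems(1,2) by (metis subsetD)
      have "T \<inter> C \<noteq> {u}" using less.prems(3)[OF C(1)] by auto
      then obtain w where w: "w \<in> T" "w \<in> C" "w \<noteq> u" using u C by blast
      obtain B where B: "B \<subseteq> F" "finite B" "\<forall>v. odd (degree B v) \<longleftrightarrow> (v = u) \<noteq> (v = w)"
        using path_join[OF component_connected[OF C w(2)]] assms(1)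
        by (auto simp: finite_graph_def)
      let ?T = "T - {u, w}"
      have "card ?T < card T" using u less.prems by (intro psubset_card_mono) auto
      moreover have "even (card (?T \<inter> D))" if D: "D \<in> components V F" for D
      proof (cases "D = C")
        case True
        have "?T \<inter> D = T \<inter> C - {u, w}" using True by auto
        moreover have "card (T \<inter> C - {u, w}) = card (T \<inter> C) - 2"
          using u w C by (subst card_Diff_subset) auto
        ultimately show ?thesis using less.prems(3)[OF C(1)] by simp
      next
        case False
        then have "?T \<inter> D = T \<inter> D" using components_disjoint[OF C(1) D] C w by auto
        then show ?thesis using less.prems(3)[OF D] by simp
      qed
      ultimately obtain A where A: "A \<subseteq> F" "\<forall>v. odd (degree A v) \<longleftrightarrow> v \<in> ?T"
        using less.hyps[of ?T] less.prems by auto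
      have "finite A" using A(1) finite_graph_finite_edges[OF assms(1)] finite_subset by blast
      then show ?thesis
        using A B u w by (intro exI[of _ "sym_diff A B"]) (auto simp: odd_degree_sym_diff simp del: odd_add)
    qed
  qed
qed

text \<open>Alternately colouring the cycles of a 2-factor leaves one bad vertex on each odd cycle.
  The colour class \<open>A\<close> is a \<open>T\<close>-join, which avoids having to traverse the cycles.\<close>

lemma two_factor_split:
  assumes "finite_graph V F"
  obtains A Q where "A \<subseteq> F" "Q \<subseteq> V" "card Q = card {C \<in> components V F. odd (card C)}"
    "\<And>v. v \<in> V - Q \<Longrightarrow> odd (degree A v)"
proof -
  let ?O = "{C \<in> components V F. odd (card C)}"
  define rep where "rep C = (SOME v. v \<in> C)" for C :: "'a set"
  have rep: "rep C \<in> C" if "C \<in> components V F" for C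
    using component_nonempty[OF that] unfolding rep_def by (simp add: some_in_eq)
  define Q where "Q = rep ` ?O"
  have inj: "inj_on rep ?O"
  proof (rule inj_onI)
    fix C D assume "C \<in> ?O" "D \<in> ?O" "rep C = rep D"
    then show "C = D" using rep[of C] rep[of D] components_disjoint[of C V F D] by auto
  qed
  have Q: "Q \<subseteq> V" using rep component_subset unfolding Q_def by fast
  have fin: "finite C" if "C \<in> components V F" for C
    using component_subset[OF that] assms finite_subset by (auto simp: finite_graph_def)
  have "even (card ((V - Q) \<inter> C))" if C: "C \<in> components V F" for C
  proof -
    have "Q \<inter> C = (if odd (card C) then {rep C} else {})"
    proof -
      have "rep D \<in> C \<Longrightarrow> D = C" if "D \<in> components V F" for D
        using components_disjoint[OF C that] rep[OF that] by auto
      then show ?thesis using rep C unfolding Q_def by auto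
    qed
    moreover have "(V - Q) \<inter> C = C - Q \<inter> C" using component_subset[OF C] by auto
    moreover have "odd (card C) \<Longrightarrow> card (C - {rep C}) = card C - 1" using rep[OF C] by simp
    ultimately show ?thesis by auto
  qed
  then obtain A where "A \<subseteq> F" "\<forall>v. odd (degree A v) \<longleftrightarrow> v \<in> V - Q"
    using T_join[OF assms, of "V - Q"] by blast
  then show thesis using that[of A Q] Q card_image[OF inj] unfolding Q_def by auto
qed

section \<open>Colourings with defective vertices\<close>

text \<open>Removed edges are put back one at a time. At the end \<open>x\<close> of
  \<open>s\<close> at most two other edges are present, so a colour is free for \<open>s\<close>
  there; any new conflict is at the other end \<open>y\<close>, which joins the defective
  vertices.\<close>

lemma recolour_removed:
  assumes "finite_graph V E" "cubic V E" "finite S"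
  shows "\<lbrakk>S \<subseteq> E; \<forall>e\<in>E. c e < (3::nat); finite Q; \<forall>v\<in>V - Q. inj_on c {e \<in> E - S. v \<in> e}\<rbrakk> \<Longrightarrow>
    \<exists>c' Q'. finite Q' \<and> card Q' \<le> card Q + card S \<and> (\<forall>e\<in>E. c' e < (3::nat)) \<and>
      (\<forall>v\<in>V - Q'. inj_on c' {e \<in> E. v \<in> e})"
  using assms(3)
proof (induction S arbitrary: c Q rule: finite_induct)
  case empty
  then show ?case by (intro exI[of _ c] exI[of _ Q]) auto
next
  case (insert s S)
  from insert.prems(1) have sE: "s \<in> E" by simp
  obtain x y where xy: "s = {x, y}" "x \<in> V" "y \<in> V"
    using assms(1) sE unfolding finite_graph_def card_2_iff by (metis insert_subset)
  have fE: "finite E" using assms(1) by (rule finite_graph_finite_edges)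
  let ?X = "{e \<in> E - insert s S. x \<in> e}"
  have "card {e \<in> E. x \<in> e} = 3" using assms(2) xy by (auto simp: cubic_def degree_def)
  moreover have "?X \<subseteq> {e \<in> E. x \<in> e} - {s}" by auto
  ultimately have "card ?X \<le> 2"
    using fE sE xy card_mono[of "{e \<in> E. x \<in> e} - {s}" ?X] by simp
  then have "card (c ` ?X) < card {..<3::nat}"
    using card_image_le[of ?X c] fE by simp
  then have "\<not> {..<3} \<subseteq> c ` ?X" using fE card_mono[of "c ` ?X" "{..<3}"] by auto
  then obtain a where a: "a < 3" "a \<notin> c ` ?X" by auto
  let ?c = "c(s := a)"
  have "inj_on ?c {e \<in> E - S. v \<in> e}" if v: "v \<in> V - insert y Q" for v
  proof (cases "v = x")
    case True
    then have "{e \<in> E - S. v \<in> e} = insert s ?X" using sE xy insert.hyps by auto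
    moreover have "inj_on c ?X" using insert.prems(4) v True by auto
    moreover have "s \<notin> ?X" by auto
    ultimately show ?thesis using a by (auto simp: inj_on_def)
  next
    case False
    then have "{e \<in> E - S. v \<in> e} = {e \<in> E - insert s S. v \<in> e}" using v xy by auto
    moreover have "inj_on c {e \<in> E - insert s S. v \<in> e}" using insert.prems(4) v by auto
    ultimately show ?thesis by (auto simp: inj_on_def)
  qed
  then have inj: "\<forall>v\<in>V - insert y Q. inj_on ?c {e \<in> E - S. v \<in> e}" by blast
  have c1: "\<forall>e\<in>E. ?c e < 3" using insert.prems(2) a(1) by simp
  have "\<exists>c' Q'. finite Q' \<and> card Q' \<le> card (insert y Q) + card S \<and> (\<forall>e\<in>E. c' e < (3::nat)) \<and>
      (\<forall>v\<in>V - Q'. inj_on c' {e \<in> E. v \<in> e})"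
    by (rule insert.IH[OF _ c1 _ inj]) (use insert.prems(1,3) in auto)
  then obtain c' Q' where "finite Q'" "card Q' \<le> card (insert y Q) + card S"
    "\<forall>e\<in>E. c' e < (3::nat)" "\<forall>v\<in>V - Q'. inj_on c' {e \<in> E. v \<in> e}"
    by blast
  moreover have "card (insert y Q) \<le> Suc (card Q)" by (rule card_insert_le_m1) auto
  ultimately show ?case using insert.hyps by (intro exI[of _ c'] exI[of _ Q']) auto
qed

lemma resistance_ge:
  assumes "finite_graph V E" "cubic V E"
    and "\<And>c Q. \<lbrakk>finite Q; \<And>e. e \<in> E \<Longrightarrow> c e < (3::nat);
      \<And>v. v \<in> V \<Longrightarrow> v \<notin> Q \<Longrightarrow> inj_on c {e \<in> E. v \<in> e}\<rbrakk> \<Longrightarrow> r \<le> card Q"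
  shows "resistance V E \<ge> r"
proof -
  have fE: "finite E" using assms(1) by (rule finite_graph_finite_edges)
  let ?P = "\<lambda>k. \<exists>S\<subseteq>E. card S = k \<and> edge_colourable 3 (E - S)"
  have "?P (card E)" by (intro exI[of _ E]) (auto simp: edge_colourable_def)
  then have "?P (resistance V E)" unfolding resistance_def by (rule LeastI)
  then obtain S c where S: "S \<subseteq> E" "card S = resistance V E" and c: "\<forall>e\<in>E - S. c e < (3::nat)"
    "\<forall>e\<in>E - S. \<forall>f\<in>E - S. e \<noteq> f \<and> e \<inter> f \<noteq> {} \<longrightarrow> c e \<noteq> c f"
    unfolding edge_colourable_def by blast
  \<comment> \<open>The value 0 on \<open>S\<close> is a placeholder: it gives every edge a colour
    below 3, and the conflicts considered are those in \<open>E - S\<close>.\<close>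
  let ?c = "\<lambda>e. if e \<in> S then 0 else c e"
  have "\<forall>v\<in>V - {}. inj_on ?c {e \<in> E - S. v \<in> e}"
    using c(2) by (auto simp: inj_on_def)
  moreover have "\<forall>e\<in>E. ?c e < 3" using c(1) by auto
  ultimately obtain c' Q' where "finite Q'" "card Q' \<le> card S" "\<forall>e\<in>E. c' e < (3::nat)"
      "\<forall>v\<in>V - Q'. inj_on c' {e \<in> E. v \<in> e}"
    using recolour_removed[OF assms(1,2) finite_subset[OF S(1) fE] S(1), of ?c "{}"] by auto
  then show ?thesis using assms(3)[of Q' c'] S(2) by fastforce
qed

text \<open>One edge is deleted at each vertex of \<open>Q\<close>. The last assumption says that a
  single deletion cures the vertex; at a vertex of degree 3 this fails only when all three colours
  agree.\<close>

lemma resistance_le: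
  assumes "finite V" "finite Q" "\<And>e. e \<in> E \<Longrightarrow> c e < (3::nat)" "\<And>e. e \<in> E \<Longrightarrow> e \<subseteq> V"
    and "\<And>v. v \<in> V \<Longrightarrow> v \<notin> Q \<Longrightarrow> inj_on c {e \<in> E. v \<in> e}"
    and "\<And>v. v \<in> Q \<Longrightarrow> \<exists>s\<in>E. v \<in> s \<and> inj_on c ({e \<in> E. v \<in> e} - {s})"
  shows "resistance V E \<le> card Q"
proof -
  obtain s where s: "\<And>v. v \<in> Q \<Longrightarrow> s v \<in> E \<and> inj_on c ({e \<in> E. v \<in> e} - {s v})"
    using assms(6) by metis
  have "c e \<noteq> c f" if "e \<in> E - s ` Q" "f \<in> E - s ` Q" "e \<noteq> f" "e \<inter> f \<noteq> {}" for e f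
  proof -
    obtain v where v: "v \<in> e" "v \<in> f" using \<open>e \<inter> f \<noteq> {}\<close> by blast
    show ?thesis
    proof (cases "v \<in> Q")
      case True
      then have "inj_on c ({e \<in> E. v \<in> e} - {s v})" "e \<noteq> s v" "f \<noteq> s v" using s that by auto
      then show ?thesis using that v by (auto dest!: inj_onD)
    next
      case False
      then have "inj_on c {e \<in> E. v \<in> e}" using assms(4,5) that v by blast
      then show ?thesis using that v by (auto dest!: inj_onD)
    qed
  qed
  then have "edge_colourable 3 (E - s ` Q)"
    unfolding edge_colourable_def using assms(3) by (intro exI[of _ c]) auto
  moreover have "s ` Q \<subseteq> E" using s by auto
  ultimately have "resistance V E \<le> card (s ` Q)"
    unfolding resistance_def by (intro Least_le) blast
  then show ?thesis using card_image_le[OF assms(2), of s] by linarith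
qed

section \<open>Rings of 4-poles\<close>

text \<open>
  \<open>Iso\<close> is the Petersen graph minus two adjacent vertices and \<open>Het\<close> the Petersen graph minus two
  nonadjacent edges; \<open>Jn\<close> is a path of length 2 whose middle vertex (number 2) is joined to the hub.
  A block has inner edges \<open>Inn q\<close>, listed with their ends in \<open>ies\<close>, and dangling edges to its left and
  right neighbours in the ring; \<open>incs\<close> gives the three edges at each vertex.
\<close>

datatype block = Iso | Het | Jn

datatype label = Inn nat | Lft nat | Rgt nat | Spk

datatype ename = Inner nat nat | Rail nat nat | Spoke nat

fun ies :: "block \<Rightarrow> (nat \<times> nat) list" where
  "ies Iso = [(0, 1), (1, 2), (2, 3), (0, 4), (1, 5), (2, 6), (3, 7), (4, 6), (5, 7), (4, 7)]"
| "ies Het = [(1, 2), (2, 3), (3, 4), (0, 4), (0, 5), (1, 6), (3, 8), (4, 9), (5, 7), (6, 8),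
     (7, 9), (5, 8), (6, 9)]"
| "ies Jn = [(0, 2), (1, 2)]"

fun incs :: "block \<Rightarrow> label list list" where
  "incs Iso = [[Inn 0, Inn 3, Lft 0], [Inn 0, Inn 1, Inn 4], [Inn 1, Inn 2, Inn 5],
     [Inn 2, Inn 6, Lft 1], [Inn 3, Inn 7, Inn 9], [Inn 4, Inn 8, Rgt 0],
     [Inn 5, Inn 7, Rgt 1], [Inn 6, Inn 8, Inn 9]]"
| "incs Het = [[Inn 3, Inn 4, Lft 0], [Inn 0, Inn 5, Lft 1], [Inn 0, Inn 1, Rgt 0],
     [Inn 1, Inn 2, Inn 6], [Inn 2, Inn 3, Inn 7], [Inn 4, Inn 8, Inn 11],
     [Inn 5, Inn 9, Inn 12], [Inn 8, Inn 10, Rgt 1], [Inn 6, Inn 9, Inn 11],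
     [Inn 7, Inn 10, Inn 12]]"
| "incs Jn = [[Lft 0, Rgt 0, Inn 0], [Lft 1, Rgt 1, Inn 1], [Inn 0, Inn 1, Spk]]"

abbreviation nv :: "block \<Rightarrow> nat" where "nv t \<equiv> length (incs t)"
abbreviation inc :: "block \<Rightarrow> nat \<Rightarrow> label list" where "inc t k \<equiv> incs t ! k"
abbreviation ne :: "block \<Rightarrow> nat" where "ne t \<equiv> length (ies t)"

fun lt :: "block \<Rightarrow> nat \<Rightarrow> nat" where
  "lt Iso j = [0, 3] ! j" | "lt Het j = [0, 1] ! j" | "lt Jn j = [0, 1] ! j"

fun rt :: "block \<Rightarrow> nat \<Rightarrow> nat" where
  "rt Iso j = [5, 6] ! j" | "rt Het j = [2, 7] ! j" | "rt Jn j = [0, 1] ! j"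

lemma less_two_iff: "j < (2::nat) \<longleftrightarrow> j = 0 \<or> j = 1" by auto

text \<open>Turns a quantifier over positions into a predicate that the simplifier evaluates along a
  concrete list, for the table checks below.\<close>

lemma all_lt_length: "(\<forall>k<length xs. P k (xs ! k)) \<longleftrightarrow> list_all (\<lambda>(k, x). P k x) (List.enumerate 0 xs)"
  by (auto simp: list_all_length nth_enumerate_eq)

text \<open>The tables \<open>ies\<close>, \<open>lt\<close>, \<open>rt\<close> are arranged by edge
  and \<open>incs\<close> by vertex. This lemma and the converses \<open>inc_Inn\<close>,
  \<open>inc_Lft\<close>, \<open>inc_Rgt\<close> certify that the two views agree.\<close>

lemma inc_valid:
  assumes "k < nv t" "l \<in> set (inc t k)"
  shows "case l of Inn q \<Rightarrow> q < ne t \<and> (fst (ies t ! q) = k \<or> snd (ies t ! q) = k)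
    | Lft j \<Rightarrow> j < 2 \<and> lt t j = k | Rgt j \<Rightarrow> j < 2 \<and> rt t j = k | Spk \<Rightarrow> t = Jn \<and> k = 2"
proof -
  have "\<forall>k<nv t. \<forall>l\<in>set (inc t k). case l of Inn q \<Rightarrow> q < ne t \<and> (fst (ies t ! q) = k \<or> snd (ies t ! q) = k)
    | Lft j \<Rightarrow> j < 2 \<and> lt t j = k | Rgt j \<Rightarrow> j < 2 \<and> rt t j = k | Spk \<Rightarrow> t = Jn \<and> k = 2"
    unfolding all_lt_length[where P = "\<lambda>k x. \<forall>l\<in>set x. P k l" for P] by (cases t) simp_all
  with assms show ?thesis by blast
qed

lemma inc_Inn:
  assumes "q < ne t" "k = fst (ies t ! q) \<or> k = snd (ies t ! q)"
  shows "k < nv t \<and> Inn q \<in> set (inc t k)"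
proof -
  have "\<forall>q<ne t. fst (ies t ! q) < nv t \<and> Inn q \<in> set (inc t (fst (ies t ! q))) \<and>
    snd (ies t ! q) < nv t \<and> Inn q \<in> set (inc t (snd (ies t ! q)))"
    by (cases t) (simp_all add: All_less_Suc numeral_eq_Suc)
  with assms show ?thesis by blast
qed

lemma inc_Lft: "j < 2 \<Longrightarrow> lt t j < nv t \<and> Lft j \<in> set (inc t (lt t j))"
  by (cases t) (auto simp: less_two_iff)

lemma inc_Rgt: "j < 2 \<Longrightarrow> rt t j < nv t \<and> Rgt j \<in> set (inc t (rt t j))"
  by (cases t) (auto simp: less_two_iff)

lemma lt_inj: "i < 2 \<Longrightarrow> j < 2 \<Longrightarrow> lt t i = lt t j \<longleftrightarrow> i = j"
  by (cases t) (auto simp: less_two_iff)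

lemma rt_inj: "i < 2 \<Longrightarrow> j < 2 \<Longrightarrow> rt t i = rt t j \<longleftrightarrow> i = j"
  by (cases t) (auto simp: less_two_iff)

lemma inc_triple: "k < nv t \<Longrightarrow> length (inc t k) = 3 \<and> distinct (inc t k)"
proof -
  have "\<forall>k<nv t. length (inc t k) = 3 \<and> distinct (inc t k)"
    unfolding all_lt_length[where P = "\<lambda>k x. length x = 3 \<and> distinct x"] by (cases t) simp_all
  then show "k < nv t \<Longrightarrow> length (inc t k) = 3 \<and> distinct (inc t k)" by blast
qed

lemma ies_neq: "q < ne t \<Longrightarrow> fst (ies t ! q) \<noteq> snd (ies t ! q)"
proof -
  have "\<forall>q<ne t. fst (ies t ! q) \<noteq> snd (ies t ! q)"
    unfolding all_lt_length[where P = "\<lambda>q x. fst x \<noteq> snd x"] by (cases t) simp_all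
  then show "q < ne t \<Longrightarrow> fst (ies t ! q) \<noteq> snd (ies t ! q)" by blast
qed

text \<open>Listing the smaller end first makes unordered pairs determine their position, and later
  lets a search over vertex prefixes test only the larger end of an edge.\<close>

lemma ies_ordered_distinct:
  "distinct (ies t) \<and> (\<forall>(a, b)\<in>set (ies t). a < b)"
  by (cases t) simp_all

lemma ies_inj:
  assumes "q < ne t" "q' < ne t"
    "{fst (ies t ! q), snd (ies t ! q)} = {fst (ies t ! q'), snd (ies t ! q')}"
  shows "q = q'"
proof -
  have "fst (ies t ! q) < snd (ies t ! q)" "fst (ies t ! q') < snd (ies t ! q')"
    using assms(1,2)[THEN nth_mem] ies_ordered_distinct[of t] by auto
  then have "ies t ! q = ies t ! q'" using assms(3)
    by (auto simp: doubleton_eq_iff prod_eq_iff)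
  then show ?thesis using assms(1,2) ies_ordered_distinct[of t] by (simp add: nth_eq_iff_index_eq)
qed

text \<open>The graph is wanted on natural numbers, so a vertex is a coded pair of block index and
  position. The hub takes the index \<open>L\<close>, which no block has.\<close>

abbreviation vt :: "nat \<Rightarrow> nat \<Rightarrow> nat" where "vt i k \<equiv> prod_encode (i, k)"

text \<open>\<open>5 \<le> L\<close> keeps four steps around the ring from closing up, which the
  girth needs. Because junctions are not adjacent, the rails of a junction lead to Iso or Het
  blocks, where the cut estimates hold.\<close>

locale block_ring =
  fixes L :: nat and ty :: "nat \<Rightarrow> block" and z1 z2 z3 :: nat
  assumes L_ge: "5 \<le> L"
    and junction_index: "z1 < L" "z2 < L" "z3 < L"
    and junction_distinct: "z1 \<noteq> z2" "z2 \<noteq> z3" "z1 \<noteq> z3"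
    and ty_Jn: "i < L \<Longrightarrow> ty i = Jn \<longleftrightarrow> i \<in> {z1, z2, z3}"
    and no_adjacent_Jn: "i < L \<Longrightarrow> ty i = Jn \<Longrightarrow> ty (if Suc i = L then 0 else Suc i) \<noteq> Jn"
begin

definition nxt :: "nat \<Rightarrow> nat" where "nxt i = (if Suc i = L then 0 else Suc i)"
definition prv :: "nat \<Rightarrow> nat" where "prv i = (if i = 0 then L - 1 else i - 1)"

lemma nxt_less: "i < L \<Longrightarrow> nxt i < L" and prv_less: "i < L \<Longrightarrow> prv i < L"
  and nxt_prv: "i < L \<Longrightarrow> nxt (prv i) = i" and prv_nxt: "i < L \<Longrightarrow> prv (nxt i) = i"
  and nxt_neq: "i < L \<Longrightarrow> nxt i \<noteq> i" and prv_neq: "i < L \<Longrightarrow> prv i \<noteq> i"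
  and nxt_neq_prv: "i < L \<Longrightarrow> nxt i \<noteq> prv i"
  using L_ge by (auto simp: nxt_def prv_def)

lemma Jn_nxt: "i < L \<Longrightarrow> ty i = Jn \<Longrightarrow> ty (nxt i) \<noteq> Jn"
  using no_adjacent_Jn by (simp add: nxt_def)

lemma Jn_prv: "i < L \<Longrightarrow> ty i = Jn \<Longrightarrow> ty (prv i) \<noteq> Jn"
  using Jn_nxt[of "prv i"] by (auto simp: prv_less nxt_prv)

definition V :: "nat set" where
  "V = {vt i k | i k. i < L \<and> k < nv (ty i)} \<union> {vt L 0}"

definition names :: "ename set" where
  "names = {Inner i q | i q. i < L \<and> q < ne (ty i)} \<union> {Rail i j | i j. i < L \<and> j < 2} \<union>
    Spoke ` {z1, z2, z3}"

fun ends :: "ename \<Rightarrow> nat set" where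
  "ends (Inner i q) = {vt i (fst (ies (ty i) ! q)), vt i (snd (ies (ty i) ! q))}"
| "ends (Rail i j) = {vt i (rt (ty i) j), vt (nxt i) (lt (ty (nxt i)) j)}"
| "ends (Spoke i) = {vt i 2, vt L 0}"

definition E :: "nat set set" where "E = ends ` names"

fun gl :: "nat \<Rightarrow> label \<Rightarrow> ename" where
  "gl i (Inn q) = Inner i q"
| "gl i (Lft j) = Rail (prv i) j"
| "gl i (Rgt j) = Rail i j"
| "gl i Spk = Spoke i"

lemma Inner_names [simp]: "Inner i q \<in> names \<longleftrightarrow> i < L \<and> q < ne (ty i)"
  and Rail_names [simp]: "Rail i j \<in> names \<longleftrightarrow> i < L \<and> j < 2"
  and Spoke_names [simp]: "Spoke i \<in> names \<longleftrightarrow> i \<in> {z1, z2, z3}"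
  by (auto simp: names_def)

lemma V_iff [simp]: "vt i k \<in> V \<longleftrightarrow> i < L \<and> k < nv (ty i) \<or> i = L \<and> k = 0"
  by (auto simp: V_def)

lemma V_cases [consumes 1, case_names block hub]:
  assumes "v \<in> V"
  obtains i k where "v = vt i k" "i < L" "k < nv (ty i)" | "v = vt L 0"
  using assms by (auto simp: V_def)

lemma names_cases [consumes 1, case_names Inner Rail Spoke]:
  assumes "n \<in> names"
  obtains i q where "n = Inner i q" "i < L" "q < ne (ty i)" | i j where "n = Rail i j" "i < L" "j < 2"
    | i where "n = Spoke i" "i \<in> {z1, z2, z3}"
  using assms by (auto simp: names_def)

lemma finite_V: "finite V"
proof -
  have "{vt i k | i k. i < L \<and> k < nv (ty i)} = (\<Union>i<L. vt i ` {..<nv (ty i)})" by auto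
  then show ?thesis by (simp add: V_def)
qed

lemma finite_names: "finite names"
proof -
  have "names = (\<Union>i<L. Inner i ` {..<ne (ty i)}) \<union> (\<Union>i<L. Rail i ` {..<2}) \<union> Spoke ` {z1, z2, z3}"
    by (auto simp: names_def)
  then show ?thesis by simp
qed

lemma junction_ty: "i \<in> {z1, z2, z3} \<Longrightarrow> i < L \<and> ty i = Jn"
  using junction_index ty_Jn by auto

lemma ends_V:
  assumes "n \<in> names" shows "ends n \<subseteq> V"
  using assms
proof (cases n rule: names_cases)
  case (Spoke i)
  then show ?thesis using junction_ty[of i] by simp
qed (use inc_Inn inc_Lft inc_Rgt nxt_less in auto)

lemma card_ends:
  assumes "n \<in> names" shows "card (ends n) = 2"
  using assms
proof (cases n rule: names_cases)
  case (Rail i j)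
  then show ?thesis using nxt_neq[of i] by simp
next
  case (Spoke i)
  then show ?thesis using junction_ty[of i] by simp
qed (use ies_neq in auto)

text \<open>This lets cardinalities of edge sets be computed on names. For two rails it uses
  \<open>nxt i \<noteq> prv i\<close>: otherwise they could join the same vertices in opposite
  directions.\<close>

lemma ends_inj: "inj_on ends names"
proof (rule inj_onI)
  fix n n' assume *: "n \<in> names" "n' \<in> names" "ends n = ends n'"
  show "n = n'"
    using *(1)
  proof (cases n rule: names_cases)
    case n: (Inner i q)
    show ?thesis using *(2)
    proof (cases n' rule: names_cases)
      case (Inner i' q')
      then show ?thesis using n *(3) ies_inj[of q "ty i" q'] by (auto simp: doubleton_eq_iff)
    next
      case (Rail i' j)
      then show ?thesis using n *(3) nxt_neq[of i'] by (auto simp: doubleton_eq_iff)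
    next
      case (Spoke i')
      then show ?thesis using n *(3) by (auto simp: doubleton_eq_iff)
    qed
  next
    case n: (Rail i j)
    show ?thesis using *(2)
    proof (cases n' rule: names_cases)
      case (Inner i' q')
      then show ?thesis using n *(3) nxt_neq[of i] by (auto simp: doubleton_eq_iff)
    next
      case (Rail i' j')
      then show ?thesis using n *(3) nxt_neq_prv[of i'] prv_nxt[of i] prv_nxt[of i'] rt_inj
        by (auto simp: doubleton_eq_iff)
    next
      case (Spoke i')
      then show ?thesis using n *(3) nxt_less[of i] by (auto simp: doubleton_eq_iff)
    qed
  next
    case n: (Spoke i)
    have "i < L" using junction_ty[OF n(2)] by simp
    show ?thesis using *(2)
    proof (cases n' rule: names_cases)
      case (Inner i' q')
      then show ?thesis using n *(3) by (auto simp: doubleton_eq_iff)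
    next
      case (Rail i' j')
      then show ?thesis using n *(3) nxt_less[of i'] by (auto simp: doubleton_eq_iff)
    next
      case (Spoke i')
      then show ?thesis using n *(3) \<open>i < L\<close> by (auto simp: doubleton_eq_iff)
    qed
  qed
qed

lemma names_at:
  assumes i: "i < L" and k: "k < nv (ty i)"
  shows "{n \<in> names. vt i k \<in> ends n} = gl i ` set (inc (ty i) k)"
proof (intro equalityI subsetI)
  fix n assume "n \<in> {n \<in> names. vt i k \<in> ends n}"
  then have n: "n \<in> names" "vt i k \<in> ends n" by auto
  from n(1) show "n \<in> gl i ` set (inc (ty i) k)"
  proof (cases n rule: names_cases)
    case (Inner i' q)
    then show ?thesis using n(2) inc_Inn[of q "ty i" k] by (intro image_eqI[of _ _ "Inn q"]) auto
  next
    case (Rail i' j)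
    then consider "i = i'" "k = rt (ty i) j" | "i = nxt i'" "k = lt (ty i) j" using n(2) by auto
    then show ?thesis
    proof cases
      case 1
      then show ?thesis using Rail inc_Rgt[of j "ty i"] by (intro image_eqI[of _ _ "Rgt j"]) auto
    next
      case 2
      then show ?thesis using Rail inc_Lft[of j "ty i"]
        by (intro image_eqI[of _ _ "Lft j"]) (auto simp: prv_nxt)
    qed
  next
    case (Spoke i')
    then show ?thesis using n(2) i junction_ty[OF Spoke(2)] by (intro image_eqI[of _ _ "Spk"]) auto
  qed
next
  fix n assume "n \<in> gl i ` set (inc (ty i) k)"
  then obtain l where l: "l \<in> set (inc (ty i) k)" "n = gl i l" by blast
  from inc_valid[OF k l(1)] show "n \<in> {n \<in> names. vt i k \<in> ends n}"
    using l(2) i ty_Jn[OF i] by (cases l) (auto simp: prv_less nxt_prv)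
qed

lemma names_at_hub: "{n \<in> names. vt L 0 \<in> ends n} = Spoke ` {z1, z2, z3}"
proof (intro equalityI subsetI)
  fix n assume "n \<in> {n \<in> names. vt L 0 \<in> ends n}"
  then show "n \<in> Spoke ` {z1, z2, z3}"
    using nxt_less by (force simp: names_def)
qed auto

lemma gl_inj: "i < L \<Longrightarrow> inj (gl i)"
  by (rule injI, case_tac x; case_tac y) (auto dest: prv_neq[of i])

lemma E_at: "{e \<in> E. v \<in> e} = ends ` {n \<in> names. v \<in> ends n}"
  by (auto simp: E_def)

lemma finite_graph_E: "finite_graph V E"
  using finite_V ends_V card_ends by (auto simp: finite_graph_def E_def)

lemma degree_ends:
  assumes "M \<subseteq> names"
  shows "degree (ends ` M) v = card {n \<in> M. v \<in> ends n}"
proof -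
  have "{e \<in> ends ` M. v \<in> e} = ends ` {n \<in> M. v \<in> ends n}" by auto
  moreover have "inj_on ends {n \<in> M. v \<in> ends n}"
    using ends_inj by (rule inj_on_subset) (use assms in auto)
  ultimately show ?thesis by (simp add: degree_def card_image)
qed

lemma cubic_E: "cubic V E"
  unfolding cubic_def
proof
  fix v assume "v \<in> V"
  then show "degree E v = 3"
  proof (cases v rule: V_cases)
    case (block i k)
    have "card (set (inc (ty i) k)) = 3"
      using inc_triple[OF block(3)] by (simp add: distinct_card)
    then show ?thesis
      using block gl_inj[of i] unfolding E_def
      by (simp add: degree_ends names_at card_image inj_on_subset[OF _ subset_UNIV])
  next
    case hub
    then show ?thesis using junction_distinct unfolding E_def
      by (simp add: degree_ends names_at_hub)
  qed
qed

end

section \<open>Colours and matchings on the dangling edges of one block\<close>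

definition third :: "nat \<Rightarrow> nat \<Rightarrow> nat" where "third a b = 3 - a - b"

definition branch :: "nat \<Rightarrow> (nat \<Rightarrow> bool) \<Rightarrow> bool" where
  "branch a P \<longleftrightarrow> (\<forall>b<3. a \<noteq> b \<longrightarrow> P b)"

lemma branch_simps:
  "branch 0 P \<longleftrightarrow> P 1 \<and> P 2" "branch (Suc 0) P \<longleftrightarrow> P 0 \<and> P 2" "branch 2 P \<longleftrightarrow> P 0 \<and> P 1"
  unfolding branch_def by (auto simp: less_Suc_eq numeral_3_eq_3 numeral_2_eq_2)

text \<open>Used as a congruence rule it lets the simplifier rewrite only the first argument, so a
  subtree stays frozen until its colour is a numeral and \<open>branch_simps\<close> can split
  it.\<close>

lemma branch_cong: "a = a' \<Longrightarrow> branch a P = branch a' P"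
  by simp

lemma branchD: "branch a P \<Longrightarrow> distinct [a, b, c] \<Longrightarrow> b < 3 \<Longrightarrow> P b"
  unfolding branch_def by auto

lemma third_eq: "distinct [a, b, c] \<Longrightarrow> a < 3 \<Longrightarrow> b < 3 \<Longrightarrow> c < 3 \<Longrightarrow> c = third a b"
  unfolding third_def by auto

lemma third_simps:
  "third 0 (Suc 0) = 2" "third 0 2 = Suc 0" "third (Suc 0) 0 = 2" "third (Suc 0) 2 = 0"
  "third 2 0 = Suc 0" "third 2 (Suc 0) = 0"
  unfolding third_def by simp_all

text \<open>A search tree of partial colourings, with \<open>x0\<close>, \<open>x1\<close>, ... the
  colours of the inner edges. Each new edge meets one already coloured, the remaining colours are
  forced through \<open>third\<close>, and the \<open>if\<close> discards the branches in which a
  vertex closes improperly.\<close>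

lemma iso_branch:
  assumes "x0 < 3"
  shows "branch x0 (\<lambda>x3. branch x0 (\<lambda>x1. branch x1 (\<lambda>x2. branch x2 (\<lambda>x6. branch x3 (\<lambda>x7. branch x6 (\<lambda>x8.
    if x8 = third x0 x1 \<or> x7 = third x1 x2 \<or> third x3 x7 \<noteq> third x6 x8 then True else
    third x0 x3 = third x2 x6 \<and> third (third x0 x1) x8 = third (third x1 x2) x7))))))"
proof -
  have "x0 = 0 \<or> x0 = 1 \<or> x0 = 2" using assms by auto
  then show ?thesis
    by (elim disjE; hypsubst; simp add: branch_simps third_simps cong: branch_cong)
qed

lemma het_branch:
  assumes "x3 < 3"
  shows "branch x3 (\<lambda>x4. branch x3 (\<lambda>x2. branch x2 (\<lambda>x1. branch x1 (\<lambda>x0. branch x0 (\<lambda>x5. branch x4 (\<lambda>x8. branch x5 (\<lambda>x9.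
    if x9 = third x1 x2 \<or> third x4 x8 \<noteq> third (third x1 x2) x9 then True else
    branch x8 (\<lambda>x10. if x10 = third x2 x3 \<or> third x5 x9 \<noteq> third (third x2 x3) x10 then True else
    third x3 x4 \<noteq> third x0 x5 \<and> third x0 x1 \<noteq> third x8 x10))))))))"
proof -
  have "x3 = 0 \<or> x3 = 1 \<or> x3 = 2" using assms by auto
  then show ?thesis
    by (elim disjE; hypsubst; simp add: branch_simps third_simps cong: branch_cong)
qed


definition proper :: "block \<Rightarrow> (label \<Rightarrow> nat) \<Rightarrow> bool" where
  "proper t f \<longleftrightarrow> (\<forall>k<nv t. distinct (map f (inc t k)) \<and> (\<forall>l\<in>set (inc t k). f l < 3))"

text \<open>Conceptually, different colours on the left would by parity reappear on the right;
  restoring the two deleted vertices, with an edge of the third colour between them, would then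
  3-edge-colour the Petersen graph. The proof follows the search tree instead.\<close>

lemma proper_Iso:
  assumes "proper Iso f"
  shows "f (Lft 0) = f (Lft 1) \<and> f (Rgt 0) = f (Rgt 1)"
proof -
  let ?x = "\<lambda>q. f (Inn q)"
  have d: "distinct [?x 0, ?x 3, f (Lft 0)]" "distinct [?x 0, ?x 1, ?x 4]" "distinct [?x 1, ?x 2, ?x 5]"
    "distinct [?x 2, ?x 6, f (Lft 1)]" "distinct [?x 3, ?x 7, ?x 9]" "distinct [?x 4, ?x 8, f (Rgt 0)]"
    "distinct [?x 5, ?x 7, f (Rgt 1)]" "distinct [?x 6, ?x 8, ?x 9]"
    and b: "?x 0 < 3" "?x 1 < 3" "?x 2 < 3" "?x 3 < 3" "?x 4 < 3" "?x 5 < 3" "?x 6 < 3" "?x 7 < 3"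
      "?x 8 < 3" "?x 9 < 3" "f (Lft 0) < 3" "f (Lft 1) < 3" "f (Rgt 0) < 3" "f (Rgt 1) < 3"
    using assms unfolding proper_def by (simp_all add: All_less_Suc numeral_eq_Suc)
  have e: "f (Lft 0) = third (?x 0) (?x 3)" "?x 4 = third (?x 0) (?x 1)" "?x 5 = third (?x 1) (?x 2)"
    "f (Lft 1) = third (?x 2) (?x 6)" "?x 9 = third (?x 3) (?x 7)" "f (Rgt 0) = third (?x 4) (?x 8)"
    "f (Rgt 1) = third (?x 5) (?x 7)" "?x 9 = third (?x 6) (?x 8)"
    using d b by (metis third_eq)+
  note branchD[OF iso_branch[OF b(1)] d(1) b(4)]
  note branchD[OF this d(2) b(2)]
  note branchD[OF this d(3) b(3)]
  note branchD[OF this d(4) b(7)]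
  note branchD[OF this d(5) b(8)]
  note branchD[OF this d(8) b(9)]
  then show ?thesis using d(6,7) e by (auto split: if_splits)
qed

text \<open>Conceptually, equal colours on one side would by parity force equal ones on the other,
  and the two deleted edges could be restored with these colours, giving a 3-edge-colouring of the
  Petersen graph.\<close>

lemma proper_Het:
  assumes "proper Het f"
  shows "f (Lft 0) \<noteq> f (Lft 1) \<and> f (Rgt 0) \<noteq> f (Rgt 1)"
proof -
  let ?x = "\<lambda>q. f (Inn q)"
  have d: "distinct [?x 3, ?x 4, f (Lft 0)]" "distinct [?x 0, ?x 5, f (Lft 1)]"
    "distinct [?x 1, ?x 0, f (Rgt 0)]" "distinct [?x 2, ?x 1, ?x 6]" "distinct [?x 3, ?x 2, ?x 7]"
    "distinct [?x 4, ?x 8, ?x 11]" "distinct [?x 5, ?x 9, ?x 12]" "distinct [?x 8, ?x 10, f (Rgt 1)]"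
    "distinct [?x 6, ?x 9, ?x 11]" "distinct [?x 7, ?x 10, ?x 12]"
    and b: "?x 0 < 3" "?x 1 < 3" "?x 2 < 3" "?x 3 < 3" "?x 4 < 3" "?x 5 < 3" "?x 6 < 3" "?x 7 < 3"
      "?x 8 < 3" "?x 9 < 3" "?x 10 < 3" "?x 11 < 3" "?x 12 < 3"
      "f (Lft 0) < 3" "f (Lft 1) < 3" "f (Rgt 0) < 3" "f (Rgt 1) < 3"
    using assms unfolding proper_def by (simp_all add: All_less_Suc numeral_eq_Suc eq_commute)
  have e: "f (Lft 0) = third (?x 3) (?x 4)" "f (Lft 1) = third (?x 0) (?x 5)"
    "f (Rgt 0) = third (?x 0) (?x 1)" "?x 6 = third (?x 1) (?x 2)" "?x 7 = third (?x 2) (?x 3)"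
    "?x 11 = third (?x 4) (?x 8)" "?x 12 = third (?x 5) (?x 9)" "f (Rgt 1) = third (?x 8) (?x 10)"
    "?x 11 = third (?x 6) (?x 9)" "?x 12 = third (?x 7) (?x 10)"
    using d b third_eq by (auto simp: third_def)
  note branchD[OF het_branch[OF b(4)] d(1) b(5)]
  note branchD[OF this d(5) b(3)]
  note branchD[OF this d(4) b(2)]
  note branchD[OF this d(3) b(1)]
  note branchD[OF this d(2) b(6)]
  note branchD[OF this d(6) b(9)]
  note * = branchD[OF this d(7) b(10)]
  \<comment> \<open>The outer \<open>if\<close> of the tree is resolved separately, because the
    choice of \<open>?x 10\<close> lies in its else branch.\<close>
  have "\<not> (?x 9 = third (?x 1) (?x 2) \<or> third (?x 4) (?x 8) \<noteq> third (third (?x 1) (?x 2)) (?x 9))"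
    using d(9) e by auto
  with * have "branch (?x 8) (\<lambda>x10. if x10 = third (?x 2) (?x 3) \<or> third (?x 5) (?x 9) \<noteq> third (third (?x 2) (?x 3)) x10 then True else
    third (?x 3) (?x 4) \<noteq> third (?x 0) (?x 5) \<and> third (?x 0) (?x 1) \<noteq> third (?x 8) x10)" by simp
  note branchD[OF this d(8) b(11)]
  then show ?thesis using d(10) e by (auto split: if_splits)
qed

text \<open>With equal colours on either side, both arms of the junction receive the same third
  colour and clash at its middle vertex.\<close>

lemma proper_Jn:
  assumes "proper Jn f"
  shows "\<not> (f (Lft 0) = f (Lft 1) \<and> f (Rgt 0) = f (Rgt 1))"
proof -
  have "distinct [f (Lft 0), f (Rgt 0), f (Inn 0)]" "distinct [f (Lft 1), f (Rgt 1), f (Inn 1)]"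
    "f (Inn 0) \<noteq> f (Inn 1)"
    and "f (Lft 0) < 3" "f (Lft 1) < 3" "f (Rgt 0) < 3" "f (Rgt 1) < 3" "f (Inn 0) < 3" "f (Inn 1) < 3"
    using assms unfolding proper_def by (simp_all add: All_less_Suc numeral_eq_Suc)
  then show ?thesis using third_eq by metis
qed

text \<open>Summed over the vertices, inner edges count twice and the others once. The junction is
  the only block with an odd number of vertices, hence the \<open>Suc\<close>.\<close>

lemma matching_parity:
  fixes g :: "label \<Rightarrow> nat"
  assumes "\<And>k. k < nv t \<Longrightarrow> (\<Sum>l\<leftarrow>inc t k. g l) = 1"
  shows "even (g (Lft 0) + g (Lft 1) + g (Rgt 0) + g (Rgt 1) + (if t = Jn then Suc (g Spk) else 0))"
proof -
  have *: "\<forall>k<nv t. (\<Sum>l\<leftarrow>inc t k. g l) = 1" using assms by blast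
  show ?thesis
  proof (cases t)
    case Iso
    let ?x = "\<lambda>q. g (Inn q)"
    have "g (Lft 0) + g (Lft 1) + g (Rgt 0) + g (Rgt 1) + 2 * (\<Sum>q<10. ?x q) = 8"
      using * unfolding Iso by (simp add: All_less_Suc numeral_eq_Suc)
    then have "even (g (Lft 0) + g (Lft 1) + g (Rgt 0) + g (Rgt 1))" by presburger
    then show ?thesis using Iso by simp
  next
    case Het
    let ?x = "\<lambda>q. g (Inn q)"
    have "g (Lft 0) + g (Lft 1) + g (Rgt 0) + g (Rgt 1) + 2 * (\<Sum>q<13. ?x q) = 10"
      using * unfolding Het by (simp add: All_less_Suc numeral_eq_Suc)
    then have "even (g (Lft 0) + g (Lft 1) + g (Rgt 0) + g (Rgt 1))" by presburger
    then show ?thesis using Het by simp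
  next
    case Jn
    have "g (Lft 0) + g (Lft 1) + g (Rgt 0) + g (Rgt 1) + g Spk + 2 * (g (Inn 0) + g (Inn 1)) = 3"
      using * unfolding Jn by (simp add: All_less_Suc numeral_eq_Suc)
    then show ?thesis using Jn by simp presburger
  qed
qed

section \<open>Rail parities of matchings and defective blocks of the ring\<close>

context block_ring
begin

lemma gl_names: "i < L \<Longrightarrow> k < nv (ty i) \<Longrightarrow> l \<in> set (inc (ty i) k) \<Longrightarrow> gl i l \<in> names"
  using names_at[of i k] by blast

lemma E_at_block:
  "i < L \<Longrightarrow> k < nv (ty i) \<Longrightarrow> {e \<in> E. vt i k \<in> e} = (\<lambda>l. ends (gl i l)) ` set (inc (ty i) k)"
  by (simp add: E_at names_at image_image)

lemma E_at_hub: "{e \<in> E. vt L 0 \<in> e} = {ends (Spoke z1), ends (Spoke z2), ends (Spoke z3)}"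
  by (simp add: E_at names_at_hub)

lemma inj_on_ends_gl:
  assumes "i < L" "k < nv (ty i)"
  shows "inj_on (\<lambda>l. ends (gl i l)) (set (inc (ty i) k))"
proof -
  have "inj_on ends (gl i ` set (inc (ty i) k))"
    using ends_inj by (rule inj_on_subset) (use gl_names[OF assms] in auto)
  then have "inj_on (ends \<circ> gl i) (set (inc (ty i) k))"
    by (intro comp_inj_on) (use gl_inj[OF assms(1)] inj_on_subset in auto)
  then show ?thesis by (simp add: comp_def)
qed

lemma degree_block:
  assumes "i < L" "k < nv (ty i)" "M \<subseteq> E"
  shows "degree M (vt i k) = (\<Sum>l\<leftarrow>inc (ty i) k. of_bool (ends (gl i l) \<in> M))"
proof -
  let ?S = "{l \<in> set (inc (ty i) k). ends (gl i l) \<in> M}"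
  have "{e \<in> M. vt i k \<in> e} = {e \<in> E. vt i k \<in> e} \<inter> M" using assms(3) by auto
  also have "\<dots> = (\<lambda>l. ends (gl i l)) ` ?S" using E_at_block[OF assms(1,2)] by auto
  finally have "degree M (vt i k) = card ?S"
    unfolding degree_def
    by (simp add: card_image[OF inj_on_subset[OF inj_on_ends_gl[OF assms(1,2)]]])
  also have "\<dots> = (\<Sum>l\<in>set (inc (ty i) k). of_bool (ends (gl i l) \<in> M))"
    by (simp add: Int_def)
  also have "\<dots> = (\<Sum>l\<leftarrow>inc (ty i) k. of_bool (ends (gl i l) \<in> M))"
    using inc_triple[OF assms(2)] by (simp add: sum_list_distinct_conv_sum_set)
  finally show ?thesis .
qed

definition rail_odd :: "nat set set \<Rightarrow> nat \<Rightarrow> bool" where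
  "rail_odd M i \<longleftrightarrow> (ends (Rail i 0) \<in> M) \<noteq> (ends (Rail i 1) \<in> M)"

lemma rail_odd_step:
  assumes M: "perfect_matching V E M" and i: "i < L"
  shows "(rail_odd M i \<longleftrightarrow> rail_odd M (prv i)) \<longleftrightarrow> (ty i = Jn \<longrightarrow> ends (Spoke i) \<in> M)"
proof -
  have "(\<Sum>l\<leftarrow>inc (ty i) k. of_bool (ends (gl i l) \<in> M)) = (1::nat)" if "k < nv (ty i)" for k
    using M i that unfolding degree_block[OF i that, symmetric, of M] perfect_matching_def
    by (subst degree_block[symmetric]) auto
  from matching_parity[of "ty i" "\<lambda>l. of_bool (ends (gl i l) \<in> M)", OF this]
  show ?thesis unfolding rail_odd_def by (auto simp: of_bool_def split: if_splits)
qed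

lemma rail_odd_run:
  assumes "perfect_matching V E M" "a \<le> i" "i < L" "\<And>j. a < j \<Longrightarrow> j \<le> i \<Longrightarrow> ty j \<noteq> Jn"
  shows "rail_odd M i \<longleftrightarrow> rail_odd M a"
  using assms(2-4)
proof (induction i rule: dec_induct)
  case (step i)
  then show ?case
    using rail_odd_step[OF assms(1), of "Suc i"] by (simp add: prv_def)
qed simp

lemma hub_matching:
  assumes "perfect_matching V E M"
  shows "\<exists>!i. i \<in> {z1, z2, z3} \<and> ends (Spoke i) \<in> M"
proof -
  have "degree M (vt L 0) = 1" using assms by (simp add: perfect_matching_def)
  then obtain e where "{e \<in> M. vt L 0 \<in> e} = {e}" unfolding degree_def by (auto simp: card_1_singleton_iff)
  moreover have "{e \<in> M. vt L 0 \<in> e} = {e \<in> E. vt L 0 \<in> e} \<inter> M"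
    using assms by (auto simp: perfect_matching_def)
  ultimately have e: "{ends (Spoke z1), ends (Spoke z2), ends (Spoke z3)} \<inter> M = {e}"
    by (simp add: E_at_hub)
  then obtain i where i: "i \<in> {z1, z2, z3}" "ends (Spoke i) = e" "e \<in> M" by blast
  have "j = i" if "j \<in> {z1, z2, z3}" "ends (Spoke j) \<in> M" for j
  proof -
    have "ends (Spoke j) = e" using e that by blast
    then show ?thesis using i ends_inj that by (metis Spoke_names ename.inject(3) inj_onD)
  qed
  then show ?thesis using i by blast
qed

text \<open>Defects are counted by block, which can only lower their number
  (\<open>card_dirty\<close>) and allows disjoint zones. A defect at the hub belongs to no block and
  is ignored in the lower bounds.\<close>

definition dirty :: "nat set \<Rightarrow> nat set" where
  "dirty Q = {i. i < L \<and> (\<exists>k<nv (ty i). vt i k \<in> Q)}"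

lemma card_dirty: "finite Q \<Longrightarrow> card (dirty Q) \<le> card Q"
proof -
  assume "finite Q"
  moreover have "dirty Q \<subseteq> (fst \<circ> prod_decode) ` Q"
    unfolding dirty_def by (force simp: image_iff)
  ultimately show ?thesis by (meson card_image_le card_mono finite_imageI le_trans)
qed

lemma finite_dirty [simp]: "finite (dirty Q)"
  by (simp add: dirty_def)

definition colours :: "(nat set \<Rightarrow> nat) \<Rightarrow> nat set \<Rightarrow> bool" where
  "colours c Q \<longleftrightarrow> (\<forall>e\<in>E. c e < 3) \<and> (\<forall>v\<in>V - Q. inj_on c {e \<in> E. v \<in> e})"

lemma clean_proper:
  assumes "colours c Q" "i < L" "i \<notin> dirty Q"
  shows "proper (ty i) (\<lambda>l. c (ends (gl i l)))"
  unfolding proper_def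
proof (intro allI impI conjI ballI)
  fix k assume k: "k < nv (ty i)"
  then have "vt i k \<in> V - Q" using assms(2,3) by (auto simp: dirty_def)
  then have "inj_on c {e \<in> E. vt i k \<in> e}" using assms(1) by (simp add: colours_def)
  then have "inj_on c ((\<lambda>l. ends (gl i l)) ` set (inc (ty i) k))"
    using E_at_block[OF assms(2) k] by simp
  then have "inj_on (c \<circ> (\<lambda>l. ends (gl i l))) (set (inc (ty i) k))"
    using inj_on_ends_gl[OF assms(2) k] by (rule comp_inj_on[rotated])
  then show "distinct (map (\<lambda>l. c (ends (gl i l))) (inc (ty i) k))"
    using inc_triple[OF k] by (simp add: distinct_map comp_def)
  show "c (ends (gl i l)) < 3" if "l \<in> set (inc (ty i) k)" for l
    using assms(1) gl_names[OF assms(2) k that] by (auto simp: colours_def E_def)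
qed

lemma clean_Iso:
  assumes "colours c Q" "i < L" "ty i = Iso" "i \<notin> dirty Q"
  shows "c (ends (Rail (prv i) 0)) = c (ends (Rail (prv i) 1))" "c (ends (Rail i 0)) = c (ends (Rail i 1))"
  using proper_Iso[OF clean_proper[OF assms(1,2,4), unfolded assms(3)]] by simp_all

lemma clean_Het:
  assumes "colours c Q" "i < L" "ty i = Het" "i \<notin> dirty Q"
  shows "c (ends (Rail (prv i) 0)) \<noteq> c (ends (Rail (prv i) 1))" "c (ends (Rail i 0)) \<noteq> c (ends (Rail i 1))"
  using proper_Het[OF clean_proper[OF assms(1,2,4), unfolded assms(3)]] by simp_all

lemma dirty_junction:
  assumes "colours c Q" "i < L" "ty (prv i) = Iso" "ty i = Jn" "ty (nxt i) = Iso"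
  shows "dirty Q \<inter> {prv i, i, nxt i} \<noteq> {}"
proof
  assume "dirty Q \<inter> {prv i, i, nxt i} = {}"
  then show False
    using proper_Jn[OF clean_proper[OF assms(1,2), unfolded assms(4)]]
      clean_Iso(2)[OF assms(1) prv_less[OF assms(2)] assms(3)]
      clean_Iso(1)[OF assms(1) nxt_less[OF assms(2)] assms(5)] assms(2)
    by (auto simp: prv_nxt)
qed

lemma dirty_change:
  assumes "colours c Q" "Suc i < L" "ty i = Iso \<and> ty (Suc i) = Het \<or> ty i = Het \<and> ty (Suc i) = Iso"
  shows "dirty Q \<inter> {i, Suc i} \<noteq> {}"
proof
  assume "dirty Q \<inter> {i, Suc i} = {}"
  moreover have "prv (Suc i) = i" by (simp add: prv_def)
  ultimately show False
    using assms clean_Iso[OF assms(1), of i] clean_Iso[OF assms(1), of "Suc i"]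
      clean_Het[OF assms(1), of i] clean_Het[OF assms(1), of "Suc i"]
    by auto
qed

lemma clean_Iso_rail_odd:
  assumes "colours c Q" "i < L" "ty i = Iso" "i \<notin> dirty Q" "\<And>e. e \<in> E \<Longrightarrow> c e = 0 \<longleftrightarrow> e \<in> M"
  shows "\<not> rail_odd M i"
proof -
  have "ends (Rail i 0) \<in> E" "ends (Rail i 1) \<in> E"
    unfolding E_def using assms(2) by (auto intro: imageI simp del: ends.simps)
  then have "ends (Rail i 0) \<in> M \<longleftrightarrow> ends (Rail i 1) \<in> M"
    using clean_Iso(2)[OF assms(1-4)] assms(5) by metis
  then show ?thesis unfolding rail_odd_def by blast
qed

end

section \<open>Cyclic connectivity and girth\<close>

definition icut :: "block \<Rightarrow> (nat \<Rightarrow> bool) \<Rightarrow> nat" where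
  "icut t f = length (filter (\<lambda>(a, b). f a \<noteq> f b) (ies t))"

definition lcount :: "block \<Rightarrow> (nat \<Rightarrow> bool) \<Rightarrow> nat" where
  "lcount t f = of_bool (f (lt t 0)) + of_bool (f (lt t 1))"

definition rcount :: "block \<Rightarrow> (nat \<Rightarrow> bool) \<Rightarrow> nat" where
  "rcount t f = of_bool (f (rt t 0)) + of_bool (f (rt t 1))"

text \<open>The sum \<open>c + l + r\<close> is the number of edges leaving the \<open>True\<close>
  vertices when everything outside the block is \<open>False\<close>. The first two claims make
  \<open>lcount\<close> a potential around the ring, the third charges every split block, and the
  fourth leaves only single vertices behind cuts of at most three edges.\<close>

definition cut_ok :: "block \<Rightarrow> bool list \<Rightarrow> bool" where
  "cut_ok t bs \<longleftrightarrow> (let f = (!) bs; c = icut t f; l = lcount t f; r = rcount t f in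
     l \<le> c + r \<and> r \<le> c + l \<and> (list_all id bs \<or> list_all Not bs \<or> 2 \<le> c) \<and>
     (length (filter id bs) \<le> 1 \<or> 4 \<le> c + l + r))"

text \<open>A branch of the search is cut as soon as four edges are split, since then all claims hold.\<close>

definition prefix_cut :: "block \<Rightarrow> bool list \<Rightarrow> nat" where
  "prefix_cut t bs = length (filter (\<lambda>(a, b). b < length bs \<and> bs ! a \<noteq> bs ! b) (ies t))"

fun search :: "block \<Rightarrow> nat \<Rightarrow> bool list \<Rightarrow> bool" where
  "search t 0 bs = cut_ok t bs"
| "search t (Suc n) bs =
    (if 4 \<le> prefix_cut t bs then True else search t n (bs @ [True]) \<and> search t n (bs @ [False]))"

lemma length_filter_mono:
  "(\<And>x. x \<in> set xs \<Longrightarrow> P x \<Longrightarrow> Q x) \<Longrightarrow> length (filter P xs) \<le> length (filter Q xs)"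
  by (induction xs) (auto intro: le_SucI)

lemma search_sound: "search t n bs \<Longrightarrow> length cs = n \<Longrightarrow> cut_ok t (bs @ cs)"
proof (induction t n bs arbitrary: cs rule: search.induct)
  case (2 t n bs)
  show ?case
  proof (cases "4 \<le> prefix_cut t bs")
    case True
    have "prefix_cut t bs \<le> icut t ((!) (bs @ cs))"
      unfolding prefix_cut_def icut_def
      by (rule length_filter_mono) (use ies_ordered_distinct[of t] in \<open>fastforce simp: nth_append\<close>)
    with True have "4 \<le> icut t ((!) (bs @ cs))" by simp
    then show ?thesis
      unfolding cut_ok_def Let_def lcount_def rcount_def by (auto simp: of_bool_def)
  next
    case False
    obtain c cs' where "cs = c # cs'" using 2(4) by (cases cs) auto
    then show ?thesis using 2 False by (cases c) fastforce+
  qed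
qed simp

lemma search_Iso: "search Iso 8 []"
  by code_simp

lemma search_Het: "search Het 10 []"
  by code_simp

lemma cut_ok_all:
  assumes "t \<noteq> Jn"
  shows "cut_ok t (map f [0..<nv t])"
  using search_sound[OF search_Iso, of "map f [0..<nv t]"]
    search_sound[OF search_Het, of "map f [0..<nv t]"] assms
  by (cases t) simp_all

lemma ies_less: "(a, b) \<in> set (ies t) \<Longrightarrow> a < nv t \<and> b < nv t"
  using inc_Inn by (metis fst_conv in_set_conv_nth snd_conv)

lemma icut_cong: "(\<And>k. k < nv t \<Longrightarrow> f k = g k) \<Longrightarrow> icut t f = icut t g"
  unfolding icut_def by (intro arg_cong[of _ _ length] filter_cong) (auto dest: ies_less)

lemma block_cut:
  assumes "t \<noteq> Jn"
  shows "lcount t f \<le> icut t f + rcount t f" "rcount t f \<le> icut t f + lcount t f"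
    and "k < nv t \<Longrightarrow> k' < nv t \<Longrightarrow> f k \<noteq> f k' \<Longrightarrow> 2 \<le> icut t f"
    and "k < nv t \<Longrightarrow> k' < nv t \<Longrightarrow> f k \<Longrightarrow> f k' \<Longrightarrow> icut t f + lcount t f + rcount t f \<le> 3 \<Longrightarrow> k = k'"
proof -
  let ?bs = "map f [0..<nv t]"
  have i: "icut t ((!) ?bs) = icut t f" by (rule icut_cong) simp
  have l: "lcount t ((!) ?bs) = lcount t f" "rcount t ((!) ?bs) = rcount t f"
    using inc_Lft[of 0 t] inc_Lft[of 1 t] inc_Rgt[of 0 t] inc_Rgt[of 1 t]
    by (simp_all add: lcount_def rcount_def)
  note * = cut_ok_all[OF assms, of f, unfolded cut_ok_def Let_def i l]
  show "lcount t f \<le> icut t f + rcount t f" "rcount t f \<le> icut t f + lcount t f"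
    using * by simp_all
  show "k < nv t \<Longrightarrow> k' < nv t \<Longrightarrow> f k \<noteq> f k' \<Longrightarrow> 2 \<le> icut t f"
    using * by (auto simp: list_all_iff)
  assume k: "k < nv t" "k' < nv t" "f k" "f k'" and c: "icut t f + lcount t f + rcount t f \<le> 3"
  have "length (filter id ?bs) = card {j. j < nv t \<and> f j}"
    by (simp add: length_filter_conv_card cong: conj_cong)
  then have "card {j. j < nv t \<and> f j} \<le> Suc 0" using * c by simp
  then show "k = k'" using k by (auto simp: card_le_Suc0_iff_eq)
qed

context block_ring
begin

definition cut :: "(nat \<Rightarrow> bool) \<Rightarrow> ename set" where
  "cut \<chi> = {n \<in> names. \<exists>u\<in>ends n. \<exists>v\<in>ends n. \<chi> u \<noteq> \<chi> v}"

abbreviation loc :: "(nat \<Rightarrow> bool) \<Rightarrow> nat \<Rightarrow> nat \<Rightarrow> bool" where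
  "loc \<chi> i \<equiv> (\<lambda>k. \<chi> (vt i k))"

definition rcut :: "(nat \<Rightarrow> bool) \<Rightarrow> nat \<Rightarrow> nat" where
  "rcut \<chi> i = of_bool (\<chi> (vt i (rt (ty i) 0)) \<noteq> \<chi> (vt (nxt i) (lt (ty (nxt i)) 0))) +
    of_bool (\<chi> (vt i (rt (ty i) 1)) \<noteq> \<chi> (vt (nxt i) (lt (ty (nxt i)) 1)))"

definition cost :: "(nat \<Rightarrow> bool) \<Rightarrow> nat \<Rightarrow> nat" where
  "cost \<chi> i = icut (ty i) (loc \<chi> i) + rcut \<chi> i"

lemma finite_cut: "finite (cut \<chi>)"
  using finite_names by (simp add: cut_def)

lemma cut_Not: "cut (\<lambda>v. \<not> \<chi> v) = cut \<chi>"
  by (simp add: cut_def)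

lemma card_block_cut:
  assumes "i < L"
  shows "card (cut \<chi> \<inter> ({Inner i q | q. q < ne (ty i)} \<union> {Rail i 0, Rail i 1})) = cost \<chi> i"
proof -
  let ?A = "{q. q < ne (ty i) \<and> loc \<chi> i (fst (ies (ty i) ! q)) \<noteq> loc \<chi> i (snd (ies (ty i) ! q))}"
  let ?R = "\<lambda>j. {n \<in> {Rail i j}. \<chi> (vt i (rt (ty i) j)) \<noteq> \<chi> (vt (nxt i) (lt (ty (nxt i)) j))}"
  have "cut \<chi> \<inter> ({Inner i q | q. q < ne (ty i)} \<union> {Rail i 0, Rail i 1}) = Inner i ` ?A \<union> (?R 0 \<union> ?R 1)"
    using assms by (auto simp: cut_def)
  moreover have "card (Inner i ` ?A \<union> (?R 0 \<union> ?R 1)) = card (Inner i ` ?A) + (card (?R 0) + card (?R 1))"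
    by (subst card_Un_disjoint, simp, simp, force, subst card_Un_disjoint) auto
  moreover have "card (Inner i ` ?A) = icut (ty i) (loc \<chi> i)"
    by (simp add: icut_def card_image inj_on_def length_filter_conv_card case_prod_beta)
  moreover have "card {n \<in> {x}. b} = of_bool b" for x :: ename and b
    by (cases b) auto
  ultimately show ?thesis by (simp only: cost_def rcut_def)
qed

text \<open>Every inner edge and rail is charged to exactly one block, a rail to the block on its
  left, and spokes to none. Hence distinct blocks and spokes account for distinct edges.\<close>

lemma cost_le_cut:
  assumes "I \<subseteq> {..<L}" "S \<subseteq> {z1, z2, z3}" "\<And>z. z \<in> S \<Longrightarrow> Spoke z \<in> cut \<chi>"
  shows "(\<Sum>i\<in>I. cost \<chi> i) + card S \<le> card (cut \<chi>)"
proof -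
  let ?B = "\<lambda>i. cut \<chi> \<inter> ({Inner i q | q. q < ne (ty i)} \<union> {Rail i 0, Rail i 1})"
  have fI: "finite I" using assms(1) finite_subset by blast
  have fS: "finite S" using assms(2) finite_subset by blast
  have "(\<Sum>i\<in>I. cost \<chi> i) = (\<Sum>i\<in>I. card (?B i))"
    using assms(1) card_block_cut by (intro sum.cong) auto
  also have "\<dots> = card (\<Union>i\<in>I. ?B i)"
    by (intro card_UN_disjoint[symmetric]) (use fI finite_cut in auto)
  finally have "(\<Sum>i\<in>I. cost \<chi> i) + card S = card ((\<Union>i\<in>I. ?B i) \<union> Spoke ` S)"
    using fI fS finite_cut by (subst card_Un_disjoint) (auto simp: card_image inj_on_def)
  also have "\<dots> \<le> card (cut \<chi>)"
    by (intro card_mono finite_cut) (use assms(3) in auto)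
  finally show ?thesis .
qed

text \<open>As a potential, \<open>lcount\<close> changes within a block by at most the split inner
  edges and across the rails by at most the split rails. In a junction the left and right ends are
  the same vertices.\<close>

lemma cost_step:
  assumes "i < L"
  shows "\<bar>int (lcount (ty i) (loc \<chi> i)) - int (lcount (ty (nxt i)) (loc \<chi> (nxt i)))\<bar> \<le> int (cost \<chi> i)"
proof -
  have "lcount (ty i) (loc \<chi> i) \<le> icut (ty i) (loc \<chi> i) + rcount (ty i) (loc \<chi> i) \<and>
    rcount (ty i) (loc \<chi> i) \<le> icut (ty i) (loc \<chi> i) + lcount (ty i) (loc \<chi> i)"
  proof (cases "ty i = Jn")
    case True
    then show ?thesis by (simp add: lcount_def rcount_def)
  next
    case False
    then show ?thesis using block_cut by simp
  qed
  moreover have "\<bar>int (rcount (ty i) (loc \<chi> i)) - int (lcount (ty (nxt i)) (loc \<chi> (nxt i)))\<bar> \<le> int (rcut \<chi> i)"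
    by (auto simp: rcount_def lcount_def rcut_def of_bool_def)
  ultimately show ?thesis unfolding cost_def by linarith
qed

lemma cost_path:
  assumes "a \<le> b" "b < L"
  shows "\<bar>int (lcount (ty a) (loc \<chi> a)) - int (lcount (ty b) (loc \<chi> b))\<bar> \<le> int (\<Sum>i\<in>{a..<b}. cost \<chi> i)"
  using assms
proof (induction b rule: dec_induct)
  case (step b)
  then show ?case using cost_step[of b \<chi>] by (simp add: nxt_def)
qed simp

lemma abs_cycle_le:
  fixes u v w x :: int
  assumes "\<bar>u - v\<bar> \<le> a" "\<bar>v - w\<bar> \<le> b" "\<bar>w - x\<bar> \<le> c" "\<bar>x - u\<bar> \<le> d"
  shows "2 * \<bar>v - w\<bar> \<le> a + b + c + d"
  using assms by (cases "w \<le> v") (simp_all add: abs_le_iff)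

text \<open>The potential difference of \<open>a\<close> and \<open>b\<close> is paid on each of the
  two arcs between them, whence the factor 2.\<close>

lemma cost_ring:
  assumes "a < b" "b < L"
  shows "2 * \<bar>int (lcount (ty a) (loc \<chi> a)) - int (lcount (ty b) (loc \<chi> b))\<bar> \<le> int (\<Sum>i<L. cost \<chi> i)"
proof -
  obtain L' where L': "L = Suc L'" using L_ge by (cases L) auto
  have "(\<Sum>i<L. cost \<chi> i) = (\<Sum>i\<in>{0..<L'}. cost \<chi> i) + cost \<chi> L'"
    by (simp add: L' lessThan_atLeast0)
  also have "(\<Sum>i\<in>{0..<L'}. cost \<chi> i) =
      (\<Sum>i\<in>{0..<a}. cost \<chi> i) + (\<Sum>i\<in>{a..<b}. cost \<chi> i) + (\<Sum>i\<in>{b..<L'}. cost \<chi> i)"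
    using assms L' by (simp add: sum.atLeastLessThan_concat)
  finally have eq: "(\<Sum>i<L. cost \<chi> i) = (\<Sum>i\<in>{0..<a}. cost \<chi> i) + (\<Sum>i\<in>{a..<b}. cost \<chi> i) +
      (\<Sum>i\<in>{b..<L'}. cost \<chi> i) + cost \<chi> L'" .
  have "nxt L' = 0" unfolding nxt_def using L' by simp
  moreover have "a \<le> b" "b \<le> L'" "L' < L" "a < L" using assms L' by auto
  ultimately show ?thesis
    using abs_cycle_le[OF cost_path[of 0 a \<chi>] cost_path[of a b \<chi>] cost_path[of b L' \<chi>]] cost_step[of L' \<chi>] assms(2)
    unfolding eq of_nat_add by simp
qed

text \<open>The two blocks would differ by 2 in potential, so the cut would contain at least four
  edges.\<close>

lemma mono_blocks_agree:
  assumes "card (cut \<chi>) \<le> 3" "i < L" "j < L" "\<And>k. k < nv (ty i) \<Longrightarrow> \<chi> (vt i k)"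
    "\<And>k. k < nv (ty j) \<Longrightarrow> \<not> \<chi> (vt j k)"
  shows False
proof -
  have "lcount (ty i) (loc \<chi> i) = 2" "lcount (ty j) (loc \<chi> j) = 0"
    using assms(4,5) inc_Lft by (simp_all add: lcount_def)
  moreover from this have "i \<noteq> j" by auto
  ultimately have "4 \<le> (\<Sum>i<L. cost \<chi> i)"
    using cost_ring[of i j \<chi>] cost_ring[of j i \<chi>] assms(2,3)
    by (cases "i < j") (simp_all del: of_nat_sum)
  then show False using cost_le_cut[of "{..<L}" "{}" \<chi>] assms(1) by simp
qed

text \<open>A core is a nonempty set inducing minimum degree at least 2. It replaces a cycle:
  every cycle is a core, and so is every side of a cut with at most one edge.\<close>

definition core :: "nat set \<Rightarrow> bool" where
  "core U \<longleftrightarrow> U \<noteq> {} \<and> U \<subseteq> V \<and> (\<forall>u\<in>U. \<exists>n\<in>names. \<exists>n'\<in>names. n \<noteq> n' \<and> u \<in> ends n \<and> u \<in> ends n' \<and>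
    ends n \<subseteq> U \<and> ends n' \<subseteq> U)"

lemma core_names:
  assumes "core U" "vt i k \<in> U" "i < L" "k < nv (ty i)"
  obtains l l' where "l \<in> set (inc (ty i) k)" "l' \<in> set (inc (ty i) k)" "l \<noteq> l'"
    "ends (gl i l) \<subseteq> U" "ends (gl i l') \<subseteq> U"
proof -
  obtain n n' where "n \<in> {n \<in> names. vt i k \<in> ends n}" "n' \<in> {n \<in> names. vt i k \<in> ends n}" "n \<noteq> n'"
    "ends n \<subseteq> U" "ends n' \<subseteq> U" using assms(1,2) unfolding core_def by blast
  then show thesis using that unfolding names_at[OF assms(3,4)] by blast
qed

text \<open>The junctions and the hub induce a tree, since no rail joins two junctions, and a tree
  contains no core. Its leaves, the junction centres and the hub are excluded in this order.\<close>

lemma core_meets_block: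
  assumes "core U"
  shows "\<exists>i k. i < L \<and> ty i \<noteq> Jn \<and> k < nv (ty i) \<and> vt i k \<in> U"
proof (rule ccontr)
  assume "\<not> ?thesis"
  then have no: "vt i k \<notin> U" if "i < L" "ty i \<noteq> Jn" "k < nv (ty i)" for i k
    using that by blast
  have xy: "vt z j \<notin> U" if z: "z < L" "ty z = Jn" "j < 2" for z j
  proof
    assume "vt z j \<in> U"
    moreover have "j < nv (ty z)" using z by simp
    ultimately obtain l l' where l: "l \<in> set (inc (ty z) j)" "l' \<in> set (inc (ty z) j)" "l \<noteq> l'"
      "ends (gl z l) \<subseteq> U" "ends (gl z l') \<subseteq> U" by (rule core_names[OF assms _ z(1)])
    have "vt (nxt z) (lt (ty (nxt z)) j) \<notin> U"
      using no[OF nxt_less[OF z(1)] Jn_nxt[OF z(1,2)]] inc_Lft[OF z(3)] by blast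
    moreover have "vt (prv z) (rt (ty (prv z)) j) \<notin> U"
      using no[OF prv_less[OF z(1)] Jn_prv[OF z(1,2)]] inc_Rgt[OF z(3)] by blast
    moreover have "inc (ty z) j = [Lft j, Rgt j, Inn j]" using z by (auto simp: less_two_iff)
    ultimately show False using l by auto
  qed
  have c: "vt z 2 \<notin> U" if z: "z < L" "ty z = Jn" for z
  proof
    assume "vt z 2 \<in> U"
    moreover have "2 < nv (ty z)" using z by simp
    ultimately obtain l l' where l: "l \<in> set (inc (ty z) 2)" "l' \<in> set (inc (ty z) 2)" "l \<noteq> l'"
      "ends (gl z l) \<subseteq> U" "ends (gl z l') \<subseteq> U" by (rule core_names[OF assms _ z(1)])
    then show False using xy[OF z, of 0] xy[OF z, of 1] z(2) by auto
  qed
  obtain u where u: "u \<in> U" "u \<in> V" using assms by (auto simp: core_def)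
  show False using u(2)
  proof (cases u rule: V_cases)
    case (block i k)
    then show False
      using u(1) no[of i k] xy[of i k] c[of i] by (cases "ty i = Jn") (auto simp: numeral_eq_Suc less_Suc_eq)
  next
    case hub
    then obtain n where "n \<in> names" "vt L 0 \<in> ends n" "ends n \<subseteq> U"
      using assms u(1) unfolding core_def by blast
    moreover from this have "n \<in> Spoke ` {z1, z2, z3}" using names_at_hub by blast
    then obtain z where "z \<in> {z1, z2, z3}" "n = Spoke z" by blast
    ultimately have "z \<in> {z1, z2, z3}" "vt z 2 \<in> U" by simp_all
    then show False using junction_ty c by blast
  qed
qed

text \<open>Every split Iso or Het block costs two edges, so only one block \<open>m\<close> can be
  split and the other ones lie on the side of \<open>i0\<close>. The one edge left cannot separate a
  junction or the hub. In \<open>m\<close> itself at most one vertex remains, which is no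
  core.\<close>

lemma no_core:
  assumes K: "card (cut \<chi>) \<le> 3" and i0: "i0 < L" "\<And>k. k < nv (ty i0) \<Longrightarrow> \<not> \<chi> (vt i0 k)"
    and U: "core U" "\<And>u. u \<in> U \<Longrightarrow> \<chi> u"
  shows False
proof -
  obtain m k0 where m: "m < L" "ty m \<noteq> Jn" "k0 < nv (ty m)" "\<chi> (vt m k0)"
    using core_meets_block[OF U(1)] U(2) by metis
  have mixed: "2 \<le> icut (ty i) (loc \<chi> i)" if "i < L" "ty i \<noteq> Jn" "k < nv (ty i)" "\<chi> (vt i k)" for i k
    using mono_blocks_agree[OF K that(1) i0(1) _ i0(2)] block_cut(3)[of "ty i" k _ "loc \<chi> i"] that by blast
  have false_block: "\<not> \<chi> (vt i k)" if "i < L" "ty i \<noteq> Jn" "k < nv (ty i)" "i \<noteq> m" for i k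
  proof
    assume "\<chi> (vt i k)"
    then show False
      using mixed[OF that(1-3)] mixed[OF m] cost_le_cut[of "{i, m}" "{}" \<chi>] that m(1) K
      by (simp add: cost_def)
  qed
  have false_Jn: "\<not> \<chi> (vt z k)" if z: "z < L" "ty z = Jn" "k < 3" for z k
  proof -
    have zm: "z \<noteq> m" using m(2) z by auto
    let ?x = "\<chi> (vt z 0)" and ?y = "\<chi> (vt z 1)" and ?c = "\<chi> (vt z 2)"
    have ic: "icut (ty z) (loc \<chi> z) = of_bool (?x \<noteq> ?c) + of_bool (?y \<noteq> ?c)"
      using z by (simp add: icut_def)
    have "icut (ty z) (loc \<chi> z) + of_bool ?x + of_bool ?y \<le> 1"
    \<comment> \<open>Only rails towards a block other than \<open>m\<close> are known to end on the
      \<open>False\<close> side. If \<open>m\<close> follows \<open>z\<close> the rails on the left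
      are used, and these are charged to \<open>prv z\<close>.\<close>
    proof (cases "nxt z = m")
      case False
      then have "rcut \<chi> z = of_bool ?x + of_bool ?y"
        using false_block[OF nxt_less[OF z(1)] Jn_nxt[OF z(1,2)]] inc_Lft[of 0 "ty (nxt z)"]
          inc_Lft[of 1 "ty (nxt z)"] z by (simp add: rcut_def)
      then show ?thesis
        using mixed[OF m] cost_le_cut[of "{z, m}" "{}" \<chi>] z m(1) K zm by (simp add: cost_def)
    next
      case True
      then have pm: "prv z \<noteq> m" using nxt_neq_prv[OF z(1)] by auto
      then have "rcut \<chi> (prv z) = of_bool ?x + of_bool ?y"
        using false_block[OF prv_less[OF z(1)] Jn_prv[OF z(1,2)]] inc_Rgt[of 0 "ty (prv z)"]
          inc_Rgt[of 1 "ty (prv z)"] z by (simp add: rcut_def nxt_prv)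
      then show ?thesis
        using mixed[OF m] cost_le_cut[of "{prv z, z, m}" "{}" \<chi>] z m(1) K zm pm prv_less prv_neq[of z]
        by (simp add: cost_def)
    qed
    then have "\<not> ?x" "\<not> ?y" "\<not> ?c" using ic by (auto simp: of_bool_def split: if_splits)
    then show ?thesis using z(3) by (auto simp: numeral_eq_Suc less_Suc_eq)
  qed
  have false_hub: "\<not> \<chi> (vt L 0)"
  proof
    assume "\<chi> (vt L 0)"
    then have "Spoke z \<in> cut \<chi>" if "z \<in> {z1, z2, z3}" for z
      using false_Jn[of z 2] junction_ty[OF that] that by (auto simp: cut_def)
    then have "3 + 2 \<le> card (cut \<chi>)"
      using mixed[OF m] cost_le_cut[of "{m}" "{z1, z2, z3}" \<chi>] m(1) junction_distinct
      by (simp add: cost_def)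
    then show False using K by simp
  qed
  have other: "\<not> \<chi> (vt i k)" if "i < L" "i \<noteq> m" "k < nv (ty i)" for i k
    using that false_block[of i k] false_Jn[of i k] by (cases "ty i = Jn") auto
  \<comment> \<open>All blocks except \<open>m\<close> are now \<open>False\<close>, so the split
    rails beside \<open>m\<close> are exactly those at its \<open>True\<close> ends, and the
    boundary of the \<open>True\<close> part of \<open>m\<close> is inside the cut.\<close>
  have "rcut \<chi> m = rcount (ty m) (loc \<chi> m)" "rcut \<chi> (prv m) = lcount (ty m) (loc \<chi> m)"
    using other[OF nxt_less[OF m(1)] nxt_neq[OF m(1)]] other[OF prv_less[OF m(1)] prv_neq[OF m(1)]]
      inc_Lft[of 0] inc_Lft[of 1] inc_Rgt[of 0] inc_Rgt[of 1] m(1)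
    by (simp_all add: rcut_def rcount_def lcount_def nxt_prv)
  then have "icut (ty m) (loc \<chi> m) + lcount (ty m) (loc \<chi> m) + rcount (ty m) (loc \<chi> m) \<le> 3"
    using cost_le_cut[of "{prv m, m}" "{}" \<chi>] m(1) prv_less prv_neq[OF m(1)] K by (simp add: cost_def)
  then have single: "k = k0" if "k < nv (ty m)" "\<chi> (vt m k)" for k
    using block_cut(4)[OF m(2), of k k0 "loc \<chi> m"] that m by simp
  have "u = vt m k0" if "u \<in> U" for u
  proof -
    have "u \<in> V" using U(1) that by (auto simp: core_def)
    then show ?thesis using U(2)[OF that] other false_hub single by (cases u rule: V_cases) auto
  qed
  then have sub: "U \<subseteq> {vt m k0}" by blast
  obtain u where "u \<in> U" using U(1) by (auto simp: core_def)
  then obtain n where "n \<in> names" "ends n \<subseteq> U" using U(1) unfolding core_def by metis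
  with sub have "n \<in> names" "ends n \<subseteq> {vt m k0}" by auto
  then show False using card_ends[of n] card_mono[of "{vt m k0}" "ends n"] by simp
qed

text \<open>The two ring neighbours of a junction are Iso or Het blocks, and splitting both would
  cost four edges. So one of them lies entirely on one side, and \<open>no_core\<close> excludes a
  core on the other side.\<close>

lemma core_one_side:
  assumes K: "card (cut \<chi>) \<le> 3" and U: "core U" "\<And>u. u \<in> U \<Longrightarrow> \<chi> u" and W: "core W" "\<And>u. u \<in> W \<Longrightarrow> \<not> \<chi> u"
  shows False
proof -
  have z: "z1 < L" "ty z1 = Jn" using junction_ty by auto
  let ?a = "nxt z1" and ?b = "prv z1"
  have ab: "?a < L" "?b < L" "ty ?a \<noteq> Jn" "ty ?b \<noteq> Jn" "?a \<noteq> ?b"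
    using z nxt_less prv_less Jn_nxt Jn_prv nxt_neq_prv by auto
  have "\<not> (2 \<le> icut (ty ?a) (loc \<chi> ?a) \<and> 2 \<le> icut (ty ?b) (loc \<chi> ?b))"
    using cost_le_cut[of "{?a, ?b}" "{}" \<chi>] ab K by (auto simp: cost_def)
  then obtain i where i: "i < L" "ty i \<noteq> Jn" "\<not> 2 \<le> icut (ty i) (loc \<chi> i)" using ab by blast
  then have "(\<forall>k<nv (ty i). \<chi> (vt i k)) \<or> (\<forall>k<nv (ty i). \<not> \<chi> (vt i k))"
    using block_cut(3)[OF i(2), of _ _ "loc \<chi> i"] by blast
  then show False
    using no_core[OF K i(1) _ U] no_core[of "\<lambda>v. \<not> \<chi> v" i W] i(1) W K by (auto simp: cut_Not)
qed

lemma cycle_core: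
  assumes p: "is_cycle V E p"
  shows "core (set p)"
  unfolding core_def
proof (intro conjI ballI)
  let ?n = "length p"
  have n: "3 \<le> ?n" "distinct p" "set p \<subseteq> V" and e: "\<And>i. i < ?n \<Longrightarrow> {p ! i, p ! (Suc i mod ?n)} \<in> E"
    using p by (auto simp: is_cycle_def)
  show "set p \<noteq> {}" using n by auto
  show "set p \<subseteq> V" by (rule n)
  fix u assume "u \<in> set p"
  then obtain i where i: "i < ?n" "u = p ! i" by (auto simp: in_set_conv_nth)
  define j where "j = (if i = 0 then ?n - 1 else i - 1)"
  have j: "j < ?n" "Suc j mod ?n = i" using i n(1) by (auto simp: j_def)
  have s: "Suc i mod ?n < ?n" using n(1) by (intro mod_less_divisor) linarith
  have "Suc i mod ?n = (if Suc i = ?n then 0 else Suc i)" using i by auto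
  then have ne: "j \<noteq> Suc i mod ?n" "Suc i mod ?n \<noteq> i" "j \<noteq> i" using n(1) i by (auto simp: j_def)
  have "{p ! j, p ! i} \<in> E" using e[OF j(1)] j(2) by simp
  then obtain b where b: "b \<in> names" "ends b = {p ! j, p ! i}" unfolding E_def by blast
  obtain a where a: "a \<in> names" "ends a = {p ! i, p ! (Suc i mod ?n)}"
    using e[OF i(1)] unfolding E_def by blast
  note ab = a b
  have "p ! (Suc i mod ?n) \<noteq> p ! j" using nth_eq_iff_index_eq[OF n(2) s j(1)] ne(1) by metis
  then have "a \<noteq> b" using ab(2,4) by (metis doubleton_eq_iff)
  then show "\<exists>n\<in>names. \<exists>n'\<in>names. n \<noteq> n' \<and> u \<in> ends n \<and> u \<in> ends n' \<and> ends n \<subseteq> set p \<and> ends n' \<subseteq> set p"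
    using ab i j(1) s nth_mem by (intro bexI[of _ a] bexI[of _ b] conjI) auto
qed

lemma cut_subset_removed:
  assumes "C \<in> components V (E - S)" "n \<in> cut (\<lambda>v. v \<in> C)"
  shows "ends n \<in> S"
proof (rule ccontr)
  assume "ends n \<notin> S"
  moreover have n: "n \<in> names" using assms(2) by (auto simp: cut_def)
  ultimately have "ends n \<in> E - S" by (auto simp: E_def)
  moreover have "finite_graph V (E - S)" using finite_graph_E finite_graph_mono by blast
  ultimately have "ends n \<subseteq> C \<or> ends n \<inter> C = {}" using edge_in_or_out assms(1) by metis
  then show False using assms(2) by (auto simp: cut_def)
qed

lemma card_cut_removed:
  assumes "C \<in> components V (E - S)" "S \<subseteq> E"
  shows "card (cut (\<lambda>v. v \<in> C)) \<le> card S"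
proof -
  have "inj_on ends (cut (\<lambda>v. v \<in> C))" using ends_inj by (rule inj_on_subset) (auto simp: cut_def)
  moreover have "finite S" using assms(2) finite_graph_finite_edges[OF finite_graph_E] finite_subset by blast
  ultimately show ?thesis
    using card_inj_on_le[of ends] cut_subset_removed[OF assms(1)] by blast
qed

lemma cyclically_4_edge_connected: "cyclically_edge_connected 4 V E"
  unfolding cyclically_edge_connected_def
proof (intro notI, elim exE conjE bexE)
  fix S C D p q
  assume S: "S \<subseteq> E" "card S < 4" and C: "C \<in> components V (E - S)" "D \<in> components V (E - S)" "C \<noteq> D"
    and p: "is_cycle V (E - S) p" "set p \<subseteq> C" and q: "is_cycle V (E - S) q" "set q \<subseteq> D"
  have "is_cycle V E p" "is_cycle V E q" using p(1) q(1) by (auto simp: is_cycle_def)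
  moreover have "C \<inter> D = {}" using components_disjoint[OF C(1,2)] C(3) by blast
  ultimately show False
    using core_one_side[of "\<lambda>v. v \<in> C" "set p" "set q"] card_cut_removed[OF C(1) S(1)] S(2)
      cycle_core p(2) q(2) by auto
qed

lemma core_of_small_cut:
  assumes K: "card (cut (\<lambda>v. v \<in> U)) \<le> 1" and U: "U \<subseteq> V" "U \<noteq> {}"
  shows "core U"
  unfolding core_def
proof (intro conjI ballI U)
  fix u assume u: "u \<in> U"
  let ?N = "{n \<in> names. u \<in> ends n}" and ?C = "cut (\<lambda>v. v \<in> U)"
  have "card ?N = 3"
    using cubic_E u U(1) degree_ends[of names u] by (auto simp: cubic_def E_def)
  then have "2 \<le> card (?N - ?C)"
    using diff_card_le_card_Diff[OF finite_cut, of ?N "\<lambda>v. v \<in> U"] K by linarith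
  then have "\<not> card (?N - ?C) \<le> Suc 0" by simp
  moreover have "finite (?N - ?C)" using finite_names by simp
  ultimately obtain n n' where "n \<in> ?N - ?C" "n' \<in> ?N - ?C" "n \<noteq> n'"
    using card_le_Suc0_iff_eq[of "?N - ?C"] by blast
  then have "n \<in> names" "n' \<in> names" "n \<noteq> n'" "u \<in> ends n" "u \<in> ends n'" "ends n \<subseteq> U" "ends n' \<subseteq> U"
    using u unfolding cut_def by blast+
  then show "\<exists>n\<in>names. \<exists>n'\<in>names. n \<noteq> n' \<and> u \<in> ends n \<and> u \<in> ends n' \<and> ends n \<subseteq> U \<and> ends n' \<subseteq> U"
    by blast
qed

text \<open>A bridge would be a cut of one edge with a core on either side, so the argument for
  cyclic connectivity covers bridges as well.\<close>

lemma bridgeless_E: "bridgeless V E"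
  unfolding bridgeless_def
proof
  fix e assume e: "e \<in> E"
  obtain a b where ab: "e = {a, b}" "a \<in> V" "b \<in> V"
    using finite_graph_E e unfolding finite_graph_def card_2_iff by (metis insert_subset)
  obtain C where C: "C \<in> components V (E - {e})" "a \<in> C" using ex_component ab(2) by metis
  have CV: "C \<subseteq> V" using component_subset C(1) by blast
  have K: "card (cut (\<lambda>v. v \<in> C)) \<le> 1" using card_cut_removed[OF C(1)] e by simp
  \<comment> \<open>The complement is taken inside \<open>V\<close> because a core must lie there.
    Edges have their ends in \<open>V\<close>, so the cut does not change.\<close>
  have "cut (\<lambda>v. v \<in> V - C) = cut (\<lambda>v. v \<in> C)"
  proof -
    have "n \<in> names \<Longrightarrow> u \<in> ends n \<Longrightarrow> u \<in> V" for n u using ends_V by blast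
    then show ?thesis unfolding cut_def by (intro Collect_cong) (metis DiffD2 DiffI)
  qed
  then have K': "card (cut (\<lambda>v. v \<in> V - C)) \<le> 1" using K by simp
  have "b \<in> C"
  proof (rule ccontr)
    assume "b \<notin> C"
    then have "core C" "core (V - C)" using core_of_small_cut[OF K CV] core_of_small_cut[OF K'] C(2) ab(3) by auto
    then show False using core_one_side[of "\<lambda>v. v \<in> C" C "V - C"] K by auto
  qed
  let ?R = "\<lambda>X. {(x, y). {x, y} \<in> X}"
  have "(a, b) \<in> (?R (E - {e}))\<^sup>*" using component_connected[OF C \<open>b \<in> C\<close>] .
  moreover from this have "(b, a) \<in> (?R (E - {e}))\<^sup>*"
    using sym_rtrancl[OF sym_adj[of "E - {e}"]] by (auto simp: sym_def)
  ultimately have "?R E \<subseteq> (?R (E - {e}))\<^sup>*"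
    using ab(1) by (auto simp: doubleton_eq_iff)
  then have "(?R E)\<^sup>* \<subseteq> (?R (E - {e}))\<^sup>*" by (rule rtrancl_subset_rtrancl)
  moreover have "(?R (E - {e}))\<^sup>* \<subseteq> (?R E)\<^sup>*" by (rule rtrancl_mono) auto
  ultimately have "connected_in V (E - {e}) = connected_in V E" unfolding connected_in_def by blast
  then show "\<not> bridge V E e" by (simp add: bridge_def components_def)
qed

end

section \<open>Absence of triangles and quadrilaterals\<close>

definition nbs :: "block \<Rightarrow> nat \<Rightarrow> nat list" where
  "nbs t k = map snd (filter (\<lambda>(a, b). a = k) (ies t)) @ map fst (filter (\<lambda>(a, b). b = k) (ies t))"

lemma nbs_iff: "k' \<in> set (nbs t k) \<longleftrightarrow> (k, k') \<in> set (ies t) \<or> (k', k) \<in> set (ies t)"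
  by (force simp: nbs_def)

lemma nbs_sym: "k' \<in> set (nbs t k) \<longleftrightarrow> k \<in> set (nbs t k')"
  by (auto simp: nbs_iff)

lemma nbs_less: "k' \<in> set (nbs t k) \<Longrightarrow> k < nv t \<and> k' < nv t"
  by (auto simp: nbs_iff dest: ies_less)

definition girth_ok :: "block \<Rightarrow> bool" where
  "girth_ok t \<longleftrightarrow> (\<forall>a\<in>set [0..<nv t]. \<forall>b\<in>set (nbs t a). \<forall>d\<in>set (nbs t a). b \<noteq> d \<longrightarrow>
      d \<notin> set (nbs t b) \<and> (\<forall>c\<in>set (nbs t b). c \<in> set (nbs t d) \<longrightarrow> c = a))"

lemma girth_ok: "girth_ok t"
proof -
  have "girth_ok Iso" "girth_ok Het" "girth_ok Jn" by code_simp+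
  then show ?thesis by (cases t) simp_all
qed

lemma block_girth:
  assumes "b \<in> set (nbs t a)" "d \<in> set (nbs t a)" "b \<noteq> d"
  shows "d \<notin> set (nbs t b)" "c \<in> set (nbs t b) \<Longrightarrow> c \<in> set (nbs t d) \<Longrightarrow> c = a"
proof -
  have "a \<in> set [0..<nv t]" using nbs_less[OF assms(1)] by simp
  then show "d \<notin> set (nbs t b)" "c \<in> set (nbs t b) \<Longrightarrow> c \<in> set (nbs t d) \<Longrightarrow> c = a"
    using girth_ok[of t, unfolded girth_ok_def] assms by blast+
qed

text \<open>Rules out a quadrilateral through the two parallel rails between consecutive
  blocks.\<close>

lemma lt_rt_nonadjacent: "i < 2 \<Longrightarrow> j < 2 \<Longrightarrow> lt t i \<notin> set (nbs t (lt t j)) \<and> rt t i \<notin> set (nbs t (rt t j))"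
  unfolding less_two_iff by (cases t; elim conjE disjE; simp add: nbs_def)

context block_ring
begin

lemma edge_cases:
  assumes "{vt i k, v} \<in> E"
  obtains (inner) k' where "i < L" "v = vt i k'" "k' \<in> set (nbs (ty i) k)"
  | (right) j where "i < L" "j < 2" "k = rt (ty i) j" "v = vt (nxt i) (lt (ty (nxt i)) j)"
  | (left) j where "i < L" "j < 2" "k = lt (ty i) j" "v = vt (prv i) (rt (ty (prv i)) j)"
  | (to_hub) "i < L" "ty i = Jn" "k = 2" "v = vt L 0"
  | (from_hub) z where "i = L" "k = 0" "z < L" "ty z = Jn" "v = vt z 2"
proof -
  obtain n where n: "n \<in> names" "ends n = {vt i k, v}" using assms by (auto simp: E_def)
  from n(1) show thesis
  proof (cases n rule: names_cases)
    case (Inner i' q)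
    have q: "ies (ty i') ! q \<in> set (ies (ty i'))" using Inner by simp
    have "i = i' \<and> (k = fst (ies (ty i) ! q) \<and> v = vt i (snd (ies (ty i) ! q)) \<or>
        k = snd (ies (ty i) ! q) \<and> v = vt i (fst (ies (ty i) ! q)))"
      using n(2) Inner by (auto simp: doubleton_eq_iff)
    then show thesis using inner Inner q by (auto simp: nbs_iff)
  next
    case (Rail i' j)
    then have "i = i' \<and> k = rt (ty i) j \<and> v = vt (nxt i) (lt (ty (nxt i)) j) \<or>
        i = nxt i' \<and> k = lt (ty i) j \<and> v = vt i' (rt (ty i') j)"
      using n(2) by (auto simp: doubleton_eq_iff)
    then show thesis using right left Rail prv_nxt[of i'] nxt_less[of i'] by auto
  next
    case (Spoke z)
    then have "i = z \<and> k = 2 \<and> v = vt L 0 \<or> i = L \<and> k = 0 \<and> v = vt z 2"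
      using n(2) by (auto simp: doubleton_eq_iff)
    then show thesis using to_hub from_hub junction_ty[OF Spoke(2)] by auto
  qed
qed

lemma nxt2_neq: "i < L \<Longrightarrow> nxt (nxt i) \<noteq> i" "i < L \<Longrightarrow> nxt (nxt i) \<noteq> prv i"
  "i < L \<Longrightarrow> nxt (nxt (nxt i)) \<noteq> i" "i < L \<Longrightarrow> nxt (nxt (nxt i)) \<noteq> prv i"
  using L_ge by (auto simp: nxt_def prv_def)

text \<open>Such a path runs along a triangle (for \<open>c = d\<close>) or a quadrilateral.\<close>

definition short_path :: "nat \<Rightarrow> nat \<Rightarrow> nat \<Rightarrow> nat \<Rightarrow> bool" where
  "short_path d a b c \<longleftrightarrow> {d, a} \<in> E \<and> {a, b} \<in> E \<and> {b, c} \<in> E \<and> d \<noteq> b \<and> c \<noteq> a \<and> (c = d \<or> {c, d} \<in> E)"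

lemma short_path_rev: "short_path d a b c \<Longrightarrow> short_path c b a d"
  unfolding short_path_def by (auto simp: insert_commute)

text \<open>From the two ends of a rail the path continues within the blocks, or past them when they
  are junctions, where left and right ends coincide. The ring is too long for these continuations to
  meet at the far side, and between the two blocks only the parallel rail could close the
  cycle.\<close>

lemma no_short_path_rail:
  assumes i: "i < L" "j < 2"
  shows "\<not> short_path d (vt i (rt (ty i) j)) (vt (nxt i) (lt (ty (nxt i)) j)) c"
proof
  let ?a = "vt i (rt (ty i) j)" and ?b = "vt (nxt i) (lt (ty (nxt i)) j)"
  assume "short_path d ?a ?b c"
  then have ed: "{?a, d} \<in> E" "{?b, c} \<in> E" and ne: "d \<noteq> ?b" "c \<noteq> ?a" and cd: "c = d \<or> {c, d} \<in> E"
    by (auto simp: short_path_def insert_commute)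
  have n: "nxt i < L" "nxt (nxt i) < L" "prv i < L" using nxt_less prv_less i by auto
  have c: "(\<exists>k. c = vt (nxt i) k \<and> k \<in> set (nbs (ty (nxt i)) (lt (ty (nxt i)) j))) \<or>
      ty (nxt i) = Jn \<and> (\<exists>j'<2. c = vt (nxt (nxt i)) (lt (ty (nxt (nxt i))) j'))"
    using ed(2)
  proof (cases rule: edge_cases)
    case (right j')
    then have "ty (nxt i) = Jn" using i(2) by (cases "ty (nxt i)") (auto simp: less_two_iff)
    then show ?thesis using right by blast
  next
    case (left j')
    then show ?thesis using ne(2) i lt_inj[of j j'] by (simp add: prv_nxt)
  qed (use n i in \<open>auto simp: less_two_iff\<close>)
  have d: "(\<exists>k. d = vt i k \<and> k \<in> set (nbs (ty i) (rt (ty i) j))) \<or>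
      ty i = Jn \<and> (\<exists>j'<2. d = vt (prv i) (rt (ty (prv i)) j'))"
    using ed(1)
  proof (cases rule: edge_cases)
    case (left j')
    then have "ty i = Jn" using i(2) by (cases "ty i") (auto simp: less_two_iff)
    then show ?thesis using left by blast
  next
    case (right j')
    then show ?thesis using ne(1) i rt_inj[of j j'] by simp
  qed (use n i in \<open>auto simp: less_two_iff\<close>)
  obtain x k y l where c': "c = vt x k" "x = nxt i \<and> k \<in> set (nbs (ty (nxt i)) (lt (ty (nxt i)) j)) \<or> x = nxt (nxt i)"
    and d': "d = vt y l" "y = i \<and> l \<in> set (nbs (ty i) (rt (ty i) j)) \<or> y = prv i"
    using c d by blast
  have xy: "x \<noteq> y" "nxt x \<noteq> y" "nxt y = x \<longrightarrow> y = i \<and> x = nxt i" "x < L" "y < L"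
    using c'(2) d'(2) nxt_neq[OF i(1)] nxt_neq_prv[OF i(1)] nxt2_neq[OF i(1)] n i nxt_prv[OF i(1)] nxt_neq[OF n(1)]
    by auto
  then have "{vt x k, vt y l} \<in> E" using cd c'(1) d'(1) by auto
  then show False
  proof (cases rule: edge_cases)
    case (left j')
    then have "y = i" "x = nxt i" using xy(3) nxt_prv[OF xy(4)] by auto
    moreover from this have "nxt (nxt i) \<noteq> x" "prv i \<noteq> y" using nxt_neq[OF n(1)] prv_neq[OF i(1)] by auto
    ultimately show False using left c'(2) lt_rt_nonadjacent[OF left(2) i(2)] by auto
  qed (use xy in auto)
qed

lemma no_short_path_spoke:
  assumes z: "z < L" "ty z = Jn"
  shows "\<not> short_path d (vt L 0) (vt z 2) c"
proof
  assume "short_path d (vt L 0) (vt z 2) c"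
  then have ed: "{vt L 0, d} \<in> E" "{vt z 2, c} \<in> E" and ne: "d \<noteq> vt z 2" "c \<noteq> vt L 0"
    and cd: "c = d \<or> {c, d} \<in> E"
    by (auto simp: short_path_def insert_commute)
  obtain z' where z': "d = vt z' 2" "z' < L" "ty z' = Jn" "z' \<noteq> z"
    using ed(1) by (cases rule: edge_cases) (use ne in auto)
  obtain k where k: "c = vt z k" "k < 2"
    using ed(2) by (cases rule: edge_cases) (use ne z in \<open>auto simp: less_two_iff nbs_def\<close>)
  have "{vt z k, vt z' 2} \<in> E" using cd k z' by auto
  then show False
    by (cases rule: edge_cases) (use z' k z Jn_nxt[OF z] Jn_prv[OF z] in auto)
qed

text \<open>A triangle or quadrilateral can be rotated to put any of its edges in the middle
  position, so the two previous lemmas leave only inner edges of a single block, where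
  \<open>block_girth\<close> applies.\<close>

lemma no_short_path: "\<not> short_path d a b c"
proof
  assume s: "short_path d a b c"
  have key: "\<exists>i k k'. i < L \<and> u = vt i k \<and> v = vt i k' \<and> k' \<in> set (nbs (ty i) k)"
    if sh: "short_path w u v x" for u v w x
  proof -
    obtain i k where u: "u = vt i k" by (metis prod_decode_inverse surj_pair)
    have "{vt i k, v} \<in> E" using sh u by (simp add: short_path_def)
    then show ?thesis
    proof (cases rule: edge_cases)
      case (inner k')
      then show ?thesis using u by blast
    next
      case (right j)
      then show ?thesis using no_short_path_rail sh u by blast
    next
      case (left j)
      then show ?thesis using no_short_path_rail[of "prv i" j x w] short_path_rev[OF sh] u
        by (simp add: prv_less nxt_prv)
    next
      case to_hub
      then show ?thesis using no_short_path_spoke[of i x w] short_path_rev[OF sh] u by simp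
    next
      case (from_hub z)
      then show ?thesis using no_short_path_spoke[of z w x] sh u by simp
    qed
  qed
  obtain i k k' where ab: "i < L" "a = vt i k" "b = vt i k'" "k' \<in> set (nbs (ty i) k)"
    using key[OF s] by blast
  show False
  proof (cases "c = d")
    case True
    have "{a} \<notin> E" "{b} \<notin> E" using finite_graph_E by (auto simp: finite_graph_def)
    then have "short_path b d a b" "short_path a b c a"
      using True s unfolding short_path_def by (auto simp: insert_commute)
    then obtain i1 l l' i2 m m' where
      "d = vt i1 l" "a = vt i1 l'" "l' \<in> set (nbs (ty i1) l)" "b = vt i2 m" "c = vt i2 m'" "m' \<in> set (nbs (ty i2) m)"
      using key by metis
    then show False using ab True block_girth(1)[of k' "ty i" k l] s
      by (auto simp: nbs_sym short_path_def)
  next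
    case False
    then have cd: "{c, d} \<in> E" using s by (simp add: short_path_def)
    then have "short_path c d a b" "short_path a b c d"
      using s unfolding short_path_def by (auto simp: insert_commute)
    moreover have "short_path b c d a"
      using s cd unfolding short_path_def by (auto simp: insert_commute)
    ultimately obtain i1 l l' i2 m m' i3 o1 o2 where
      "d = vt i1 l" "a = vt i1 l'" "l' \<in> set (nbs (ty i1) l)" "b = vt i2 m" "c = vt i2 m'" "m' \<in> set (nbs (ty i2) m)"
      "c = vt i3 o1" "d = vt i3 o2" "o2 \<in> set (nbs (ty i3) o1)"
      using key by metis
    then show False using ab False block_girth(2)[of k' "ty i" k l m'] s
      by (auto simp: nbs_sym short_path_def)
  qed
qed

lemma girth_ge_5: "5 \<le> girth V E"
  unfolding girth_def
proof (rule INF_greatest)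
  fix p assume "p \<in> {p. is_cycle V E p}"
  then have p: "3 \<le> length p" "distinct p" and e: "\<And>i. i < length p \<Longrightarrow> {p ! i, p ! (Suc i mod length p)} \<in> E"
    by (auto simp: is_cycle_def)
  have "5 \<le> length p"
  proof (rule ccontr)
    assume "\<not> 5 \<le> length p"
    then consider "length p = 3" | "length p = 4" using p(1) by linarith
    then show False
    proof cases
      case 1
      have "{p ! 0, p ! 1} \<in> E" "{p ! 1, p ! 2} \<in> E" "{p ! 2, p ! 0} \<in> E"
        using e[of 0] e[of 1] e[of 2] unfolding 1 by (simp_all flip: numeral_2_eq_2)
      moreover have "p ! 0 \<noteq> p ! 1" "p ! 1 \<noteq> p ! 2" "p ! 0 \<noteq> p ! 2"
        using 1 p(2) by (simp_all add: nth_eq_iff_index_eq)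
      ultimately have "short_path (p ! 2) (p ! 0) (p ! 1) (p ! 2)" by (auto simp: short_path_def)
      then show False using no_short_path by blast
    next
      case 2
      have "{p ! 0, p ! 1} \<in> E" "{p ! 1, p ! 2} \<in> E" "{p ! 2, p ! 3} \<in> E" "{p ! 3, p ! 0} \<in> E"
        using e[of 0] e[of 1] e[of 2] e[of 3] unfolding 2 by (simp_all flip: numeral_2_eq_2 numeral_3_eq_3)
      moreover have "p ! 3 \<noteq> p ! 1" "p ! 0 \<noteq> p ! 2"
        using 2 p(2) by (simp_all add: nth_eq_iff_index_eq)
      ultimately have "short_path (p ! 3) (p ! 0) (p ! 1) (p ! 2)" by (auto simp: short_path_def)
      then show False using no_short_path by blast
    qed
  qed
  then show "5 \<le> enat (length p)" by (simp add: numeral_eq_enat)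
qed

end

section \<open>Assembling colourings block by block\<close>

definition block_colour :: "nat list \<Rightarrow> nat \<times> nat \<Rightarrow> nat \<times> nat \<Rightarrow> nat \<Rightarrow> label \<Rightarrow> nat" where
  "block_colour cs l r s lab = (case lab of Inn q \<Rightarrow> cs ! q | Lft j \<Rightarrow> if j = 0 then fst l else snd l
    | Rgt j \<Rightarrow> if j = 0 then fst r else snd r | Spk \<Rightarrow> s)"

text \<open>The colours \<open>l\<close>, \<open>r\<close> and \<open>s\<close> of the left rails, right rails and spoke extend to the block
  with no conflict, or, when \<open>d\<close> holds, with at most one vertex of colours \<open>x, y, y\<close>.
  With \<open>m\<close>, colour 0 is required to be a perfect matching even at a defective vertex.\<close>

definition extends_by :: "nat list \<Rightarrow> nat \<Rightarrow> bool \<Rightarrow> block \<Rightarrow> nat \<times> nat \<Rightarrow> nat \<times> nat \<Rightarrow> nat \<Rightarrow> bool \<Rightarrow> bool" where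
  "extends_by cs k0 m t l r s d \<longleftrightarrow> (\<forall>k\<in>set [0..<nv t]. let f = block_colour cs l r s; xs = inc t k in
     (\<forall>x\<in>set xs. f x < 3) \<and> (m \<longrightarrow> length (filter (\<lambda>x. f x = 0) xs) = 1) \<and>
     (if d \<and> k = k0 then \<not> (f (xs ! 0) = f (xs ! 1) \<and> f (xs ! 1) = f (xs ! 2)) else distinct (map f xs)))"

definition extendable :: "bool \<Rightarrow> block \<Rightarrow> nat \<times> nat \<Rightarrow> nat \<times> nat \<Rightarrow> nat \<Rightarrow> bool \<Rightarrow> bool" where
  "extendable m t l r s d \<longleftrightarrow> (\<exists>cs k0. extends_by cs k0 m t l r s d)"

lemma Collect_image_filter:
  "(\<And>l. l \<in> S \<Longrightarrow> P (g l) \<longleftrightarrow> R l) \<Longrightarrow> {e \<in> g ` S. P e} = g ` {l \<in> S. R l}"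
  by auto

lemma inj_on_remove_one:
  assumes "\<not> (c x = c y \<and> c y = c z)"
  shows "\<exists>s\<in>{x, y}. inj_on c ({x, y, z} - {s})"
proof (cases "c y = c z")
  case True
  then have "inj_on c ({x, y, z} - {y})" using assms by (auto simp: inj_on_def)
  then show ?thesis by blast
next
  case False
  then have "inj_on c ({x, y, z} - {x})" by (auto simp: inj_on_def)
  then show ?thesis by blast
qed

context block_ring
begin

text \<open>Blocks share only rails, and meet the hub only in spokes. So block colourings that
  respect the prescribed colours, \<open>\<rho> i\<close> on the rails to the right of block
  \<open>i\<close> and \<open>\<sigma>\<close> on the spokes, fit together. Distinct spoke colours
  keep the hub free of defects.\<close>

lemma assemble:
  assumes ext: "\<And>i. i < L \<Longrightarrow> extendable m (ty i) (\<rho> (prv i)) (\<rho> i) (\<sigma> i) (i \<in> D)"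
    and D: "finite D" and hub: "distinct [\<sigma> z1, \<sigma> z2, \<sigma> z3]"
  shows "\<exists>c Q. finite Q \<and> card Q \<le> card D \<and> colours c Q \<and>
    (\<forall>v\<in>Q. \<exists>s\<in>E. v \<in> s \<and> inj_on c ({e \<in> E. v \<in> e} - {s})) \<and>
    (m \<longrightarrow> 0 \<in> {\<sigma> z1, \<sigma> z2, \<sigma> z3} \<longrightarrow> (\<forall>v\<in>V. card {e \<in> E. v \<in> e \<and> c e = 0} = 1))"
proof -
  obtain cs k0 where cs: "\<And>i. i < L \<Longrightarrow>
      extends_by (cs i) (k0 i) m (ty i) (\<rho> (prv i)) (\<rho> i) (\<sigma> i) (i \<in> D)"
    using ext unfolding extendable_def by metis
  define col where "col n = (case n of Inner i q \<Rightarrow> cs i ! q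
    | Rail i j \<Rightarrow> if j = 0 then fst (\<rho> i) else snd (\<rho> i) | Spoke i \<Rightarrow> \<sigma> i)" for n
  define c where "c e = col (inv_into names ends e)" for e
  have c: "c (ends n) = col n" if "n \<in> names" for n
    using ends_inj that by (simp add: c_def)
  let ?f = "\<lambda>i. block_colour (cs i) (\<rho> (prv i)) (\<rho> i) (\<sigma> i)"
  have cf: "c (ends (gl i l)) = ?f i l" if "i < L" "k < nv (ty i)" "l \<in> set (inc (ty i) k)" for i k l
    using c[OF gl_names[OF that]] by (cases l) (simp_all add: col_def block_colour_def)
  have at: "{e \<in> E. vt i k \<in> e} = (\<lambda>l. ends (gl i l)) ` set (inc (ty i) k)"
    "inj_on (\<lambda>l. ends (gl i l)) (set (inc (ty i) k))"
    "map (\<lambda>l. c (ends (gl i l))) (inc (ty i) k) = map (?f i) (inc (ty i) k)"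
    if "i < L" "k < nv (ty i)" for i k
    using E_at_block[OF that] inj_on_ends_gl[OF that] cf[OF that] by auto
  have local: "\<forall>x\<in>set (inc (ty i) k). ?f i x < 3"
    "m \<longrightarrow> length (filter (\<lambda>x. ?f i x = 0) (inc (ty i) k)) = 1"
    "if i \<in> D \<and> k = k0 i then \<not> (?f i (inc (ty i) k ! 0) = ?f i (inc (ty i) k ! 1) \<and>
       ?f i (inc (ty i) k ! 1) = ?f i (inc (ty i) k ! 2)) else distinct (map (?f i) (inc (ty i) k))"
    if "i < L" "k < nv (ty i)" for i k
  proof -
    have "k \<in> set [0..<nv (ty i)]" using that(2) by simp
    from cs[OF that(1), unfolded extends_by_def Let_def, rule_format, OF this]
    show "\<forall>x\<in>set (inc (ty i) k). ?f i x < 3"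
      "m \<longrightarrow> length (filter (\<lambda>x. ?f i x = 0) (inc (ty i) k)) = 1"
      "if i \<in> D \<and> k = k0 i then \<not> (?f i (inc (ty i) k ! 0) = ?f i (inc (ty i) k ! 1) \<and>
         ?f i (inc (ty i) k ! 1) = ?f i (inc (ty i) k ! 2)) else distinct (map (?f i) (inc (ty i) k))"
      by blast+
  qed
  define Q where "Q = {v. \<exists>i. v = vt i (k0 i) \<and> i \<in> D \<and> i < L \<and> k0 i < nv (ty i)}"
  have "Q \<subseteq> (\<lambda>i. vt i (k0 i)) ` D" unfolding Q_def by auto
  moreover have "finite ((\<lambda>i. vt i (k0 i)) ` D)" using D by simp
  ultimately have Q: "finite Q" "card Q \<le> card D"
    using finite_subset card_mono[of "(\<lambda>i. vt i (k0 i)) ` D" Q] card_image_le[OF D, of "\<lambda>i. vt i (k0 i)"] by auto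
  have less: "c e < 3" if e: "e \<in> E" for e
  proof -
    obtain v where v: "v \<in> e" "v \<in> V" 
    proof -
      have "e \<subseteq> V" "card e = 2" using finite_graph_E e by (auto simp: finite_graph_def)
      moreover from this have "e \<noteq> {}" by auto
      ultimately show thesis using that by blast
    qed
    from v(2) show ?thesis
    proof (cases v rule: V_cases)
      case (block i k)
      then have "e \<in> (\<lambda>l. ends (gl i l)) ` set (inc (ty i) k)" using at(1)[of i k] v(1) e by blast
      then show ?thesis using local(1)[OF block(2,3)] cf[OF block(2,3)] by auto
    next
      case hub
      then have "e \<in> {e \<in> E. vt L 0 \<in> e}" using e v(1) by simp
      then obtain z where z: "z \<in> {z1, z2, z3}" "e = ends (Spoke z)" unfolding E_at_hub by blast
      then have "z < L" "ty z = Jn" using junction_ty by auto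
      then have "?f z Spk < 3" using local(1)[of z 2] by simp
      then show ?thesis using z c[of "Spoke z"] by (simp add: col_def block_colour_def)
    qed
  qed
  have inj: "inj_on c {e \<in> E. v \<in> e}" if v: "v \<in> V - Q" for v
  proof -
    have "v \<in> V" using v by simp
    then show ?thesis
    proof (cases v rule: V_cases)
      case (block i k)
      then have "\<not> (i \<in> D \<and> k = k0 i)" using v unfolding Q_def by blast
      then have "distinct (map (?f i) (inc (ty i) k))" using local(3)[OF block(2,3)] by (simp only: if_False)
      then have "distinct (map (\<lambda>l. c (ends (gl i l))) (inc (ty i) k))" by (simp only: at(3)[OF block(2,3)])
      then have "inj_on (c \<circ> (\<lambda>l. ends (gl i l))) (set (inc (ty i) k))"
        by (simp add: distinct_map comp_def)
      then show ?thesis using at(1)[OF block(2,3)] block(1) by (metis inj_on_imageI)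
    next
      case hub
      then show ?thesis using \<open>distinct [\<sigma> z1, \<sigma> z2, \<sigma> z3]\<close> c[of "Spoke z1"] c[of "Spoke z2"] c[of "Spoke z3"]
        unfolding hub E_at_hub by (auto simp: col_def inj_on_def)
    qed
  qed
  have rem: "\<exists>s\<in>E. v \<in> s \<and> inj_on c ({e \<in> E. v \<in> e} - {s})" if v: "v \<in> Q" for v
  proof -
    obtain i where i: "v = vt i (k0 i)" "i \<in> D" "i < L" "k0 i < nv (ty i)" using v by (auto simp: Q_def)
    obtain a b d where abd: "inc (ty i) (k0 i) = [a, b, d]"
      using inc_triple[OF i(4)] by (auto simp: length_Suc_conv numeral_eq_Suc)
    let ?e = "\<lambda>l. ends (gl i l)"
    have E: "{e \<in> E. v \<in> e} = {?e a, ?e b, ?e d}" using at(1)[OF i(3,4)] i(1) abd by simp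
    have "\<not> (c (?e a) = c (?e b) \<and> c (?e b) = c (?e d))"
      using local(3)[OF i(3,4)] i(2) cf[OF i(3,4)] abd by simp
    then obtain s where "s \<in> {?e a, ?e b}" "inj_on c ({?e a, ?e b, ?e d} - {s})"
      using inj_on_remove_one by metis
    moreover from this have "s \<in> {e \<in> E. v \<in> e}" unfolding E by auto
    ultimately show ?thesis unfolding E[symmetric] by blast
  qed
  have zero: "card {e \<in> E. v \<in> e \<and> c e = 0} = 1"
    if m: m and z: "0 \<in> {\<sigma> z1, \<sigma> z2, \<sigma> z3}" and v: "v \<in> V" for v
    using v
  proof (cases v rule: V_cases)
    case (block i k)
    let ?S = "filter (\<lambda>x. ?f i x = 0) (inc (ty i) k)"
    have "{e \<in> E. v \<in> e \<and> c e = 0} = {e \<in> {e \<in> E. vt i k \<in> e}. c e = 0}" using block by auto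
    also have "\<dots> = (\<lambda>l. ends (gl i l)) ` set ?S"
    proof -
      have "\<forall>l\<in>set (inc (ty i) k). c (ends (gl i l)) = 0 \<longleftrightarrow> ?f i l = 0"
        using cf[OF block(2,3)] by simp
      then have "{e \<in> (\<lambda>l. ends (gl i l)) ` set (inc (ty i) k). c e = 0} =
          (\<lambda>l. ends (gl i l)) ` {l \<in> set (inc (ty i) k). ?f i l = 0}"
        by (intro Collect_image_filter) blast
      then show ?thesis unfolding at(1)[OF block(2,3)] set_filter .
    qed
    also have "card \<dots> = card (set ?S)"
      by (rule card_image[OF inj_on_subset[OF at(2)[OF block(2,3)]]]) simp
    also have "\<dots> = length ?S"
      by (rule distinct_card) (simp add: inc_triple[OF block(3)])
    finally show ?thesis using local(2)[OF block(2,3)] m by simp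
  next
    case hub
    have "{e \<in> E. v \<in> e \<and> c e = 0} = {e \<in> {e \<in> E. vt L 0 \<in> e}. c e = 0}" using hub by auto
    also have "\<dots> = {e \<in> {ends (Spoke z1), ends (Spoke z2), ends (Spoke z3)}. c e = 0}"
      unfolding E_at_hub ..
    finally have eq: "{e \<in> E. v \<in> e \<and> c e = 0} =
      {e \<in> {ends (Spoke z1), ends (Spoke z2), ends (Spoke z3)}. c e = 0}" .
    have "\<exists>s. {e \<in> {ends (Spoke z1), ends (Spoke z2), ends (Spoke z3)}. c e = 0} = {s}"
      using z \<open>distinct [\<sigma> z1, \<sigma> z2, \<sigma> z3]\<close> c[of "Spoke z1"] c[of "Spoke z2"] c[of "Spoke z3"]
      by (auto simp: col_def simp del: ends.simps)
    then have "\<exists>s. {e \<in> E. v \<in> e \<and> c e = 0} = {s}" by (simp only: eq)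
    then show ?thesis by (metis is_singletonI is_singleton_altdef)
  qed
  show ?thesis
    using Q less inj rem zero unfolding colours_def by (intro exI[of _ c] exI[of _ Q]) blast
qed

lemma resistance_upper:
  assumes "\<And>i. i < L \<Longrightarrow> extendable False (ty i) (\<rho> (prv i)) (\<rho> i) (\<sigma> i) (i \<in> D)"
    and "finite D" "distinct [\<sigma> z1, \<sigma> z2, \<sigma> z3]"
  shows "resistance V E \<le> card D"
proof -
  obtain c Q where Q: "finite Q" "card Q \<le> card D" and c: "colours c Q"
    "\<forall>v\<in>Q. \<exists>s\<in>E. v \<in> s \<and> inj_on c ({e \<in> E. v \<in> e} - {s})"
    using assemble[OF assms] by blast
  have "resistance V E \<le> card Q"
    by (rule resistance_le[where c = c])
      (use finite_V Q c finite_graph_E in \<open>auto simp: colours_def finite_graph_def\<close>)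
  then show ?thesis using Q by simp
qed

lemma degree_split:
  assumes "v \<in> V"
  shows "degree {e \<in> E. P e} v + degree {e \<in> E. \<not> P e} v = 3"
proof -
  have "finite E" using finite_graph_E by (rule finite_graph_finite_edges)
  then have "card {e \<in> {e \<in> E. P e}. v \<in> e} + card {e \<in> {e \<in> E. \<not> P e}. v \<in> e} =
      card ({e \<in> {e \<in> E. P e}. v \<in> e} \<union> {e \<in> {e \<in> E. \<not> P e}. v \<in> e})"
    by (intro card_Un_disjoint[symmetric]) auto
  also have "{e \<in> {e \<in> E. P e}. v \<in> e} \<union> {e \<in> {e \<in> E. \<not> P e}. v \<in> e} = {e \<in> E. v \<in> e}" by auto
  also have "card \<dots> = 3" using cubic_E assms by (simp add: cubic_def degree_def)
  finally show ?thesis unfolding degree_def .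
qed

text \<open>Colour 0 is a perfect matching even at the defects, so its complement is a 2-factor.
  Colour 1 meets every vertex outside \<open>Q\<close> exactly once, and
  \<open>odd_components_le\<close> applies.\<close>

lemma oddness_upper:
  assumes "\<And>i. i < L \<Longrightarrow> extendable True (ty i) (\<rho> (prv i)) (\<rho> i) (\<sigma> i) (i \<in> D)"
    and "finite D" "distinct [\<sigma> z1, \<sigma> z2, \<sigma> z3]" "0 \<in> {\<sigma> z1, \<sigma> z2, \<sigma> z3}"
  shows "oddness V E \<le> card D" "\<exists>F. two_factor V E F" "\<exists>M. perfect_matching V E M"
proof -
  obtain c Q where Q: "finite Q" "card Q \<le> card D" and c: "colours c Q"
    and zero: "\<forall>v\<in>V. card {e \<in> E. v \<in> e \<and> c e = 0} = 1"
    using assemble[OF assms(1-3)] assms(4) by blast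
  define F where "F = {e \<in> E. c e \<noteq> 0}"
  define A where "A = {e \<in> E. c e = 1}"
  have fE: "finite E" using finite_graph_E by (rule finite_graph_finite_edges)
  have M: "degree {e \<in> E. c e = 0} v = 1" if "v \<in> V" for v
    using zero that by (simp add: degree_def conj_ac)
  then show "\<exists>M. perfect_matching V E M"
    unfolding perfect_matching_def by (intro exI[of _ "{e \<in> E. c e = 0}"]) auto
  have "degree F v = 2" if "v \<in> V" for v
    using degree_split[OF that, of "\<lambda>e. c e = 0"] M[OF that] by (simp add: F_def)
  then have F: "two_factor V E F" by (auto simp: two_factor_def F_def)
  then show "\<exists>F. two_factor V E F" by blast
  have "degree A v = 1" if v: "v \<in> V - Q" for v
  proof -
    let ?N = "{e \<in> E. v \<in> e}"
    have inj: "inj_on c ?N" and le: "c ` ?N \<subseteq> {..<3}" using c v by (auto simp: colours_def)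
    have "card ?N = 3" using cubic_E v by (simp add: cubic_def degree_def)
    then have "c ` ?N = {..<3}"
      using le inj card_image[OF inj] by (intro card_subset_eq) auto
    then have "1 \<in> c ` ?N" by simp
    then obtain e where e: "e \<in> ?N" "c e = 1" by (elim imageE) simp
    have "f = e" if "f \<in> ?N" "c f = 1" for f using inj_onD[OF inj _ that(1) e(1)] that(2) e(2) by simp
    then have "{f \<in> A. v \<in> f} = {e}" using e unfolding A_def by blast
    then show ?thesis by (simp add: degree_def)
  qed
  moreover have "A \<subseteq> F" by (auto simp: A_def F_def)
  moreover have "finite_graph V F" using finite_graph_E by (rule finite_graph_mono) (auto simp: F_def)
  ultimately have "card {C \<in> components V F. odd (card C)} \<le> card Q"
    by (intro odd_components_le[OF _ _ Q(1)])
  moreover have "oddness V E \<le> card {C \<in> components V F. odd (card C)}"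
    unfolding oddness_def using F by (intro Least_le) blast
  ultimately show "oddness V E \<le> card D" using Q(2) by simp
qed

text \<open>The complement of a 2-factor gets colour 0, the set \<open>A\<close> of
  \<open>two_factor_split\<close> colour 1, the rest colour 2. Outside \<open>Q\<close> the degree
  of \<open>A\<close> is odd and at most 2, hence 1, and the colouring is proper.\<close>

lemma oddness_lower:
  assumes ex: "\<exists>F. two_factor V E F"
    and bound: "\<And>c Q M. \<lbrakk>finite Q; colours c Q; perfect_matching V E M; \<And>e. e \<in> E \<Longrightarrow> c e = 0 \<longleftrightarrow> e \<in> M\<rbrakk> \<Longrightarrow> w \<le> card Q"
  shows "w \<le> oddness V E"
proof -
  let ?P = "\<lambda>k. \<exists>F. two_factor V E F \<and> card {C \<in> components V F. odd (card C)} = k"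
  have "?P (oddness V E)" unfolding oddness_def by (rule LeastI_ex) (use ex in blast)
  then obtain F where F: "two_factor V E F" "card {C \<in> components V F. odd (card C)} = oddness V E" by blast
  have fF: "finite_graph V F" using finite_graph_E F(1) finite_graph_mono by (auto simp: two_factor_def)
  obtain A Q where A: "A \<subseteq> F" and Q: "Q \<subseteq> V" "card Q = oddness V E" and odd: "\<And>v. v \<in> V - Q \<Longrightarrow> odd (degree A v)"
    using two_factor_split[OF fF] F(2) by metis
  have FE: "F \<subseteq> E" using F by (simp add: two_factor_def)
  have fE: "finite E" using finite_graph_E by (rule finite_graph_finite_edges)
  define M where "M = {e \<in> E. e \<notin> F}"
  define c where "c e = (if e \<in> M then 0 else if e \<in> A then 1 else (2::nat))" for e :: "nat set"
  have F': "{e \<in> E. e \<in> F} = F" using FE by auto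
  have degM: "degree M v = 1" if "v \<in> V" for v
    using degree_split[OF that, of "\<lambda>e. e \<in> F"] F(1) that by (simp add: M_def F' two_factor_def)
  then have M: "perfect_matching V E M" by (auto simp: perfect_matching_def M_def)
  have "inj_on c {e \<in> E. v \<in> e}" if v: "v \<in> V - Q" for v
  proof (rule inj_onI)
    fix e f assume ef: "e \<in> {e \<in> E. v \<in> e}" "f \<in> {e \<in> E. v \<in> e}" "c e = c f"
    have sub: "{e \<in> A. v \<in> e} \<subseteq> {e \<in> F. v \<in> e}" using A by auto
    have fin: "finite {e \<in> F. v \<in> e}" using finite_subset[OF FE fE] by simp
    have degF: "card {e \<in> F. v \<in> e} = 2" using F(1) v by (auto simp: two_factor_def degree_def)
    then have "card {e \<in> A. v \<in> e} \<le> 2" using card_mono[OF fin sub] by simp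
    moreover have "odd (card {e \<in> A. v \<in> e})" using odd[OF v] by (simp add: degree_def)
    ultimately have degA: "card {e \<in> A. v \<in> e} = 1" by presburger
    have "{e \<in> F - A. v \<in> e} = {e \<in> F. v \<in> e} - {e \<in> A. v \<in> e}" by auto
    then have degB: "card {e \<in> F - A. v \<in> e} = 1"
      using degA degF sub fin by (simp add: card_Diff_subset finite_subset)
    have one: "e = f" if X: "card {e \<in> X. v \<in> e} = 1" "e \<in> X" "f \<in> X" for X
    proof -
      obtain x where "{e \<in> X. v \<in> e} = {x}" using X(1) by (rule card_1_singletonE)
      moreover have "e \<in> {e \<in> X. v \<in> e}" "f \<in> {e \<in> X. v \<in> e}" using X(2,3) ef(1,2) by simp_all
      ultimately show ?thesis by simp
    qed
    have "e \<in> M \<and> f \<in> M \<or> e \<in> A \<and> f \<in> A \<or> e \<in> F - A \<and> f \<in> F - A"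
      using ef by (auto simp: c_def M_def split: if_splits)
    then show "e = f"
      using one[OF degA] one[OF degB] one[OF degM[of v, unfolded degree_def]] v by blast
  qed
  then have "colours c Q" by (auto simp: colours_def c_def)
  moreover have "finite Q" using Q(1) finite_V finite_subset by blast
  moreover have "c e = 0 \<longleftrightarrow> e \<in> M" for e by (simp add: c_def)
  ultimately show ?thesis using bound[of Q c M] M Q(2) by auto
qed

text \<open>Three perfect matchings covering the three edges at a vertex must take one each. So at a
  vertex outside \<open>W\<close> they are disjoint, and the first matching containing an edge can
  serve as its colour.\<close>

lemma matchings_colouring:
  assumes M: "perfect_matching V E M1" "perfect_matching V E M2" "perfect_matching V E M3"
    and W: "\<And>e. e \<in> E \<Longrightarrow> e \<notin> M1 \<Longrightarrow> e \<notin> M2 \<Longrightarrow> e \<notin> M3 \<Longrightarrow> e \<subseteq> W"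
  shows "colours (\<lambda>e. if e \<in> M1 then 0 else if e \<in> M2 then 1 else 2) W"
    "v \<in> V - W \<Longrightarrow> e \<in> E \<Longrightarrow> v \<in> e \<Longrightarrow> e \<in> M1 \<Longrightarrow> e \<notin> M2"
proof -
  have one: "e = f" if "perfect_matching V E X" "v \<in> V" "v \<in> e" "v \<in> f" "e \<in> X" "f \<in> X" for X v e f
  proof -
    have "card {e \<in> X. v \<in> e} = 1" using that(1,2) by (simp add: perfect_matching_def degree_def)
    then obtain x where "{e \<in> X. v \<in> e} = {x}" by (rule card_1_singletonE)
    moreover have "e \<in> {e \<in> X. v \<in> e}" "f \<in> {e \<in> X. v \<in> e}" using that(3-6) by simp_all
    ultimately show ?thesis by simp
  qed
  have covered: "e \<in> M1 \<or> e \<in> M2 \<or> e \<in> M3" if "v \<in> V - W" "e \<in> E" "v \<in> e" for v e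
    using W[OF that(2)] that by blast
  show "colours (\<lambda>e. if e \<in> M1 then 0 else if e \<in> M2 then 1 else 2) W"
    unfolding colours_def
  proof (intro conjI ballI inj_onI)
    fix v e f assume v: "v \<in> V - W" and ef: "e \<in> {e \<in> E. v \<in> e}" "f \<in> {e \<in> E. v \<in> e}"
      "(if e \<in> M1 then 0 else if e \<in> M2 then 1 else 2) = (if f \<in> M1 then 0 else if f \<in> M2 then 1 else (2::nat))"
    then have "e \<in> M1 \<and> f \<in> M1 \<or> e \<in> M2 \<and> f \<in> M2 \<or> e \<in> M3 \<and> f \<in> M3"
      using covered[OF v, of e] covered[OF v, of f] by (simp split: if_splits)
    moreover have "v \<in> V" "v \<in> e" "v \<in> f" using v ef by auto
    ultimately show "e = f" using one[OF M(1)] one[OF M(2)] one[OF M(3)] by metis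
  qed simp
  assume v: "v \<in> V - W" and e: "e \<in> E" "v \<in> e" "e \<in> M1"
  show "e \<notin> M2"
  proof
    assume "e \<in> M2"
    obtain g where g: "{f \<in> M3. v \<in> f} = {g}"
      using M(3) v by (auto simp: perfect_matching_def degree_def card_1_singleton_iff)
    have "{f \<in> E. v \<in> f} \<subseteq> {e, g}"
    proof
      fix f assume "f \<in> {f \<in> E. v \<in> f}"
      then show "f \<in> {e, g}"
        using covered[OF v, of f] one[OF M(1) _ e(2) _ e(3)] one[OF M(2) _ e(2) _ \<open>e \<in> M2\<close>] g v by blast
    qed
    then have "card {f \<in> E. v \<in> f} \<le> card {e, g}" by (intro card_mono) auto
    also have "\<dots> \<le> 2" by (simp add: card_insert_if)
    finally show False using cubic_E v by (simp add: cubic_def degree_def)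
  qed
qed

end

text \<open>Each witness list colours the inner edges in the order of \<open>ies\<close>. The number
  after it is the defective vertex, or a dummy 0 when there is none.\<close>

lemma modes_Iso:
  "extendable True Iso (1, 1) (1, 1) s False" "extendable True Iso (0, 0) (0, 0) s False"
  "extendable True Iso (2, 2) (0, 0) s False" "extendable True Iso (0, 2) (0, 1) s True"
  "extendable True Iso (0, 1) (0, 2) s True" "extendable True Iso (2, 1) (0, 0) s True"
proof -
  have "extends_by [0, 1, 0, 2, 2, 2, 2, 0, 0, 1] 0 True Iso (1, 1) (1, 1) s False"
    "extends_by [1, 0, 1, 2, 2, 2, 2, 1, 1, 0] 0 True Iso (0, 0) (0, 0) s False"
    "extends_by [0, 2, 0, 1, 1, 1, 1, 2, 2, 0] 0 True Iso (2, 2) (0, 0) s False"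
    "extends_by [1, 0, 1, 1, 2, 2, 0, 0, 1, 2] 0 True Iso (0, 2) (0, 1) s True"
    "extends_by [1, 0, 2, 1, 2, 1, 0, 0, 1, 2] 0 True Iso (0, 1) (0, 2) s True"
    "extends_by [0, 1, 0, 1, 2, 1, 2, 2, 1, 0] 2 True Iso (2, 1) (0, 0) s True"
    by (simp_all add: extends_by_def block_colour_def upt_rec Let_def)
  then show "extendable True Iso (1, 1) (1, 1) s False" "extendable True Iso (0, 0) (0, 0) s False"
    "extendable True Iso (2, 2) (0, 0) s False" "extendable True Iso (0, 2) (0, 1) s True"
    "extendable True Iso (0, 1) (0, 2) s True" "extendable True Iso (2, 1) (0, 0) s True"
    unfolding extendable_def by blast+
qed

lemma modes_Het:
  "extendable True Het (0, 1) (0, 1) s False" "extendable True Het (0, 2) (0, 2) s False"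
  "extendable True Het (2, 1) (2, 1) s False" "extendable True Het (0, 0) (2, 1) s True"
  "extendable False Het (0, 0) (0, 1) s True" "extendable False Het (0, 0) (0, 2) s True"
proof -
  have "extends_by [2, 1, 2, 1, 2, 0, 0, 0, 0, 2, 2, 1, 1] 0 True Het (0, 1) (0, 1) s False"
    "extends_by [1, 2, 0, 1, 2, 0, 1, 2, 1, 2, 0, 0, 1] 0 True Het (0, 2) (0, 2) s False"
    "extends_by [0, 1, 2, 0, 1, 2, 0, 1, 0, 1, 2, 2, 0] 0 True Het (2, 1) (2, 1) s False"
    "extends_by [1, 0, 2, 1, 1, 2, 1, 0, 0, 0, 2, 2, 1] 0 True Het (0, 0) (2, 1) s True"
    "extends_by [2, 1, 2, 0, 2, 1, 0, 1, 0, 2, 2, 1, 0] 0 False Het (0, 0) (0, 1) s True"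
    "extends_by [1, 2, 1, 0, 1, 2, 0, 2, 0, 1, 1, 2, 0] 0 False Het (0, 0) (0, 2) s True"
    by (simp_all add: extends_by_def block_colour_def upt_rec Let_def)
  then show "extendable True Het (0, 1) (0, 1) s False" "extendable True Het (0, 2) (0, 2) s False"
    "extendable True Het (2, 1) (2, 1) s False" "extendable True Het (0, 0) (2, 1) s True"
    "extendable False Het (0, 0) (0, 1) s True" "extendable False Het (0, 0) (0, 2) s True"
    unfolding extendable_def by blast+
qed

lemma modes_Jn:
  "extendable True Jn (1, 1) (0, 2) 1 False" "extendable False Jn (1, 1) (0, 0) 1 True"
  "extendable True Jn (0, 1) (2, 2) 2 False" "extendable True Jn (0, 2) (2, 1) 2 False"
  "extendable True Jn (0, 0) (1, 1) 0 True"
proof -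
  have "extends_by [2, 0] 0 True Jn (1, 1) (0, 2) 1 False" "extends_by [2, 2] 2 False Jn (1, 1) (0, 0) 1 True"
    "extends_by [1, 0] 0 True Jn (0, 1) (2, 2) 2 False" "extends_by [1, 0] 0 True Jn (0, 2) (2, 1) 2 False"
    "extends_by [2, 2] 2 True Jn (0, 0) (1, 1) 0 True"
    by (simp_all add: extends_by_def block_colour_def upt_rec Let_def)
  then show "extendable True Jn (1, 1) (0, 2) 1 False" "extendable False Jn (1, 1) (0, 0) 1 True"
    "extendable True Jn (0, 1) (2, 2) 2 False" "extendable True Jn (0, 2) (2, 1) 2 False"
    "extendable True Jn (0, 0) (1, 1) 0 True"
    unfolding extendable_def by blast+
qed

lemma extendable_weaken: "extendable True t l r s d \<Longrightarrow> extendable m t l r s d"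
  unfolding extendable_def extends_by_def Let_def by metis

section \<open>The snarks\<close>

text \<open>
  Around the ring there are a junction, \<open>p\<close> blocks \<open>Iso\<close>, \<open>N\<close> blocks \<open>Het\<close>, a junction, \<open>t\<close> pairs of
  equal blocks alternating in type and ending with \<open>Het\<close>, \<open>N\<close> blocks \<open>Iso\<close>, a junction, \<open>N\<close> blocks \<open>Iso\<close>.
\<close>

definition parity_block :: "nat \<Rightarrow> block" where
  "parity_block n = (if even n then Iso else Het)"

lemma parity_block_neq [simp]: "parity_block n \<noteq> Jn"
  by (simp add: parity_block_def)

definition ring_ty :: "nat \<Rightarrow> nat \<Rightarrow> nat \<Rightarrow> nat \<Rightarrow> block" where
  "ring_ty p N t i =
    (if i = 0 then Jn else if i \<le> p then Iso else if i \<le> p + N then Het else if i = p + N + 1 then Jn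
     else if i < p + N + 2 + 2 * t then parity_block ((i - (p + N + 2)) div 2 + t)
     else if i = p + N + 2 + 2 * t + N then Jn else Iso)"

locale snark_ring =
  fixes p N t :: nat
  assumes p_ge: "2 \<le> p" and N_ge: "2 \<le> N"
begin

definition J2 :: nat where "J2 = p + N + 1"
definition J3 :: nat where "J3 = p + N + 2 + 2 * t + N"
definition Len :: nat where "Len = J3 + 1 + N"

lemmas index_defs = J2_def J3_def Len_def

abbreviation "rty \<equiv> ring_ty p N t"

lemma rty_Jn: "i < Len \<Longrightarrow> rty i = Jn \<longleftrightarrow> i \<in> {0, J2, J3}"
proof -
  consider "i = 0" | "0 < i" "i \<le> p" | "p < i" "i \<le> p + N" | "i = p + N + 1"
    | "p + N + 1 < i" "i < p + N + 2 + 2 * t" | "p + N + 2 + 2 * t \<le> i" by linarith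
  then show ?thesis
  proof cases
    case 2
    then have "rty i \<noteq> Jn" "i \<noteq> J2" "i \<noteq> J3" unfolding ring_ty_def J2_def J3_def by simp_all
    then show ?thesis using 2 by simp
  next
    case 3
    then have "rty i \<noteq> Jn" "i \<noteq> J2" "i \<noteq> J3" unfolding ring_ty_def J2_def J3_def by simp_all
    then show ?thesis using 3 by simp
  next
    case 4
    then show ?thesis unfolding ring_ty_def J2_def by simp
  next
    case 5
    then have "rty i \<noteq> Jn" "i \<noteq> J2" "i \<noteq> J3" unfolding ring_ty_def J2_def J3_def by simp_all
    then show ?thesis using 5 by simp
  next
    case 6
    then have "rty i = Jn \<longleftrightarrow> i = J3" "i \<noteq> J2" unfolding ring_ty_def J2_def J3_def by simp_all
    then show ?thesis using 6 by simp
  qed (simp add: ring_ty_def)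
qed

sublocale block_ring Len rty 0 J2 J3
proof
  show "5 \<le> Len" "0 < Len" "J2 < Len" "J3 < Len" "0 \<noteq> J2" "J2 \<noteq> J3" "0 \<noteq> J3"
    using p_ge N_ge by (auto simp: index_defs)
  show "rty i = Jn \<longleftrightarrow> i \<in> {0, J2, J3}" if "i < Len" for i using rty_Jn[OF that] .
  show "rty (if Suc i = Len then 0 else Suc i) \<noteq> Jn" if "i < Len" "rty i = Jn" for i
  proof -
    have "i = 0 \<or> i = J2 \<or> i = J3" using that rty_Jn[OF that(1)] by simp
    then have "Suc i < Len \<and> Suc i \<noteq> J2 \<and> Suc i \<noteq> J3"
      using p_ge N_ge unfolding index_defs by (elim disjE) simp_all
    then show ?thesis using rty_Jn[of "Suc i"] by simp
  qed
qed

lemma nxt_Suc: "Suc i < Len \<Longrightarrow> nxt i = Suc i"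
  by (simp add: nxt_def)

lemma prv_pos: "0 < i \<Longrightarrow> prv i = i - 1" and prv_0: "prv 0 = Len - 1"
  by (simp_all add: prv_def)

text \<open>Adding \<open>t\<close> in the argument of \<open>parity_block\<close> makes the last
  pair, \<open>s = t - 1\<close>, a pair of Het blocks next to an Iso run. Using pairs instead of
  single blocks makes the contacts between different types disjoint.\<close>

lemma rty_run1: "1 \<le> i \<Longrightarrow> i \<le> p \<Longrightarrow> rty i = Iso"
  and rty_run2: "p < i \<Longrightarrow> i \<le> p + N \<Longrightarrow> rty i = Het"
  and rty_segment: "s < t \<Longrightarrow> q < 2 \<Longrightarrow> rty (p + N + 2 + 2 * s + q) = parity_block (s + t)"
  and rty_run3: "p + N + 2 + 2 * t \<le> i \<Longrightarrow> i < J3 \<Longrightarrow> rty i = Iso"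
  and rty_run4: "J3 < i \<Longrightarrow> rty i = Iso"
proof -
  show "1 \<le> i \<Longrightarrow> i \<le> p \<Longrightarrow> rty i = Iso" "p < i \<Longrightarrow> i \<le> p + N \<Longrightarrow> rty i = Het"
    by (simp_all add: ring_ty_def)
  show "p + N + 2 + 2 * t \<le> i \<Longrightarrow> i < J3 \<Longrightarrow> rty i = Iso" "J3 < i \<Longrightarrow> rty i = Iso"
    by (simp_all add: ring_ty_def J3_def)
  assume "s < t" "q < 2"
  moreover from this have "(p + N + 2 + 2 * s + q - (p + N + 2)) div 2 = s" by simp
  ultimately show "rty (p + N + 2 + 2 * s + q) = parity_block (s + t)"
    unfolding ring_ty_def by simp
qed

section \<open>Lower bounds for resistance, oddness and colouring defect\<close>

lemma change_dirty:
  assumes c: "colours c Q" and s: "s < t"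
  shows "dirty Q \<inter> {p + N + 3 + 2 * s, p + N + 4 + 2 * s} \<noteq> {}"
proof -
  let ?i = "p + N + 3 + 2 * s"
  have "?i = p + N + 2 + 2 * s + 1" by simp
  moreover have i': "Suc ?i = p + N + 2 + 2 * Suc s + 0" by simp
  ultimately have "rty ?i = (if even (s + t) then Iso else Het)"
    using rty_segment[OF s, of 1] by (simp only: parity_block_def)
  moreover have "rty (Suc ?i) = (if even (s + t) then Het else Iso)"
  proof (cases "Suc s < t")
    case True
    then have "rty (Suc ?i) = parity_block (Suc s + t)" unfolding i' by (intro rty_segment) simp_all
    then show ?thesis by (simp add: parity_block_def)
  next
    case False
    then have "Suc s = t" using s by simp
    then show ?thesis using rty_run3[of "Suc ?i"] N_ge by (auto simp: J3_def)
  qed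
  moreover have "Suc ?i < Len" using s by (auto simp: index_defs)
  ultimately show ?thesis
    using dirty_change[OF c, of ?i] by (auto simp: numeral_eq_Suc split: if_splits)
qed

lemma junction3_dirty:
  assumes c: "colours c Q"
  shows "dirty Q \<inter> {J3 - 1, J3, J3 + 1} \<noteq> {}"
proof -
  have "J3 < Len" "0 < J3" "Suc J3 < Len" using N_ge by (auto simp: index_defs)
  moreover have "rty (J3 - 1) = Iso" using rty_run3[of "J3 - 1"] N_ge by (auto simp: J3_def)
  moreover have "rty (Suc J3) = Iso" using rty_run4 by simp
  moreover have "rty J3 = Jn" using rty_Jn calculation by simp
  ultimately show ?thesis using dirty_junction[OF c, of J3] by (simp add: prv_pos nxt_Suc)
qed

lemma junction1_dirty:
  assumes c: "colours c Q"
  shows "dirty Q \<inter> {Len - 1, 0, 1} \<noteq> {}"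
proof -
  have "0 < Len" "Suc 0 < Len" "J3 < Len - 1" using N_ge by (auto simp: index_defs)
  moreover have "rty (Suc 0) = Iso" using rty_run1 p_ge by simp
  moreover have "rty 0 = Jn" using rty_Jn calculation by simp
  ultimately show ?thesis using dirty_junction[OF c, of 0] rty_run4 by (simp add: prv_0 nxt_Suc)
qed

lemma run_dirty:
  assumes c: "colours c Q"
  shows "dirty Q \<inter> {p, Suc p} \<noteq> {}"
  using dirty_change[OF c, of p] rty_run1[of p] rty_run2[of "Suc p"] p_ge N_ge by (simp add: index_defs)

text \<open>The zones are the first and third junction with their neighbours, the contact after the
  first Iso run, and the \<open>t\<close> contacts in the paired part. \<open>2 \<le> p\<close> and
  \<open>2 \<le> N\<close> keep them disjoint. The second junction has no zone, since it follows a
  Het block and can be coloured properly.\<close>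

lemma resistance_bound:
  assumes "finite Q" "colours c Q"
  shows "t + 3 \<le> card Q"
proof -
  let ?G = "\<lambda>j. if j = 0 then {Len - 1, 0, 1} else if j = 1 then {p, Suc p}
    else if j = 2 then {J3 - 1, J3, J3 + 1}
    else {p + N + 3 + 2 * (j - 3), p + N + 4 + 2 * (j - 3)}"
  have "card {..<t + 3} \<le> card (dirty Q)"
  proof (rule card_disjoint_hits_le[where G = ?G])
    fix j assume "j \<in> {..<t + 3}"
    then have "2 < j \<Longrightarrow> j - 3 < t" by auto
    then show "dirty Q \<inter> ?G j \<noteq> {}"
      using junction1_dirty[OF assms(2)] run_dirty[OF assms(2)] junction3_dirty[OF assms(2)]
        change_dirty[OF assms(2), of "j - 3"] by auto
  next
    fix i j assume "i \<in> {..<t + 3}" "j \<in> {..<t + 3}" "i \<noteq> j"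
    then show "?G i \<inter> ?G j = {}"
      using p_ge N_ge by (auto simp: index_defs split: if_splits)
  qed simp_all
  then show ?thesis using card_dirty[OF assms(1), of] by simp
qed

lemma resistance_ge_t: "t + 3 \<le> resistance V E"
proof (rule resistance_ge[OF finite_graph_E cubic_E])
  fix c Q assume "finite Q" "\<And>e. e \<in> E \<Longrightarrow> c e < (3::nat)"
    "\<And>v. v \<in> V \<Longrightarrow> v \<notin> Q \<Longrightarrow> inj_on c {e \<in> E. v \<in> e}"
  then show "t + 3 \<le> card Q" using resistance_bound[of Q c] by (auto simp: colours_def)
qed

lemma clean_in_run:
  assumes "card (dirty Q) < card I" "I \<subseteq> {..<Len}"
  obtains i where "i \<in> I" "i \<notin> dirty Q"
  using card_mono[OF finite_dirty, of I Q] assms(1) by (metis leD subsetI)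

text \<open>Zero sum on the two long runs next to the third junction puts its spoke into the matching,
  hence the matching is odd on the rails between the first two junctions.\<close>

lemma forced_odd:
  assumes M: "perfect_matching V E M" and a: "p + N + 2 + 2 * t \<le> a" "a < J3" "\<not> rail_odd M a"
    and b: "J3 < b" "b < Len" "\<not> rail_odd M b" and i: "i \<le> p + N"
  shows "rail_odd M i"
proof -
  have jn: "0 < Len" "J3 < Len" "J3 - 1 < Len" "Len - 1 < Len" "J3 \<le> Len - 1" "rty J3 = Jn" "rty 0 = Jn"
    using rty_Jn by (auto simp: index_defs)
  have mid: "rty j \<noteq> Jn" if "J2 < j" "j < J3" for j
    using that rty_Jn[of j] by (auto simp: index_defs)
  have "rail_odd M a \<longleftrightarrow> rail_odd M J2"
    by (rule rail_odd_run[OF M]) (use a mid in \<open>auto simp: index_defs\<close>)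
  moreover have "rail_odd M (J3 - 1) \<longleftrightarrow> rail_odd M J2"
    by (rule rail_odd_run[OF M]) (use mid in \<open>auto simp: index_defs\<close>)
  moreover have "rail_odd M b \<longleftrightarrow> rail_odd M J3" "rail_odd M (Len - 1) \<longleftrightarrow> rail_odd M J3"
    by (rule rail_odd_run[OF M]; use b rty_run4 in \<open>auto simp: index_defs\<close>)+
  ultimately have no: "\<not> rail_odd M (prv J3)" "\<not> rail_odd M J3" "\<not> rail_odd M (prv 0)"
    using a(3) b(3) by (auto simp: prv_pos prv_0 J3_def)
  then have "ends (Spoke J3) \<in> M" using rail_odd_step[OF M, of J3] jn by simp
  moreover have "0 \<noteq> J3" by (simp add: J3_def)
  ultimately have "ends (Spoke 0) \<notin> M" using hub_matching[OF M] by blast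
  then have "rail_odd M 0" using rail_odd_step[OF M, of 0] jn no(3) by simp
  moreover have "rail_odd M i \<longleftrightarrow> rail_odd M 0"
  proof (rule rail_odd_run[OF M])
    show "i < Len" using i by (simp add: index_defs)
    show "rty j \<noteq> Jn" if "0 < j" "j \<le> i" for j
      using rty_run1[of j] rty_run2[of j] that i by (cases "j \<le> p") simp_all
  qed simp
  ultimately show ?thesis by simp
qed

text \<open>With fewer than \<open>N\<close> dirty blocks both long Iso runs contain a clean one,
  and \<open>forced_odd\<close> makes all \<open>p\<close> Iso blocks of the first run dirty. The
  zones at the two ends of that run overlap it and are not counted again.\<close>

lemma oddness_bound:
  assumes "finite Q" "colours c Q" and M: "perfect_matching V E M" "\<And>e. e \<in> E \<Longrightarrow> c e = 0 \<longleftrightarrow> e \<in> M"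
    and N: "p + t + 1 \<le> N"
  shows "p + t + 1 \<le> card Q"
proof (rule ccontr)
  assume *: "\<not> ?thesis"
  then have d: "card (dirty Q) < N" using card_dirty[OF assms(1)] N by linarith
  obtain a where a: "a \<in> {p + N + 2 + 2 * t..<J3}" "a \<notin> dirty Q"
    by (rule clean_in_run[of Q "{p + N + 2 + 2 * t..<J3}"]) (use d in \<open>auto simp: index_defs\<close>)
  obtain b where b: "b \<in> {J3<..<Len}" "b \<notin> dirty Q"
    by (rule clean_in_run[of Q "{J3<..<Len}"]) (use d in \<open>auto simp: index_defs\<close>)
  have even: "\<not> rail_odd M i" if "i < Len" "rty i = Iso" "i \<notin> dirty Q" for i
    using clean_Iso_rail_odd[OF assms(2) that M(2)] by blast
  have "i \<in> dirty Q" if "1 \<le> i" "i \<le> p" for i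
  proof (rule ccontr)
    assume "i \<notin> dirty Q"
    then have "\<not> rail_odd M i" using even[of i] rty_run1 that by (simp add: index_defs)
    moreover have "\<not> rail_odd M a" "\<not> rail_odd M b"
      using even[of a] even[of b] a b rty_run3[of a] rty_run4[of b] by (auto simp: Len_def)
    ultimately show False using forced_odd[OF M(1), of a b i] a b that by auto
  qed
  then have run: "dirty Q \<inter> {Suc j} \<noteq> {}" if "j < p" for j using that by auto
  let ?G = "\<lambda>j. if j < p then {Suc j} else if j = p then {J3 - 1, J3, J3 + 1}
    else {p + N + 3 + 2 * (j - p - 1), p + N + 4 + 2 * (j - p - 1)}"
  have "card {..<p + t + 1} \<le> card (dirty Q)"
  proof (rule card_disjoint_hits_le[where G = ?G])
    fix j assume "j \<in> {..<p + t + 1}"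
    then have "p < j \<Longrightarrow> j - p - 1 < t" by auto
    then show "dirty Q \<inter> ?G j \<noteq> {}"
      using run[of j] junction3_dirty[OF assms(2)] change_dirty[OF assms(2), of "j - p - 1"] by auto
  next
    fix i j assume "i \<in> {..<p + t + 1}" "j \<in> {..<p + t + 1}" "i \<noteq> j"
    then show "?G i \<inter> ?G j = {}"
      using p_ge N_ge by (auto simp: index_defs split: if_splits)
  qed simp_all
  then show False using * card_dirty[OF assms(1)] by simp
qed

text \<open>The ends of the uncovered edges play the role of defective vertices, and each edge has
  two, which explains the factor.\<close>

lemma defect_bound:
  assumes M: "perfect_matching V E M1" "perfect_matching V E M2" "perfect_matching V E M3"
  shows "N \<le> 2 * card (E - (M1 \<union> M2 \<union> M3))"
proof (rule ccontr)
  assume *: "\<not> ?thesis"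
  let ?D = "E - (M1 \<union> M2 \<union> M3)"
  define W where "W = \<Union> ?D"
  have fin: "finite ?D" using finite_graph_finite_edges[OF finite_graph_E] by simp
  have two: "card e = 2 \<and> finite e" if "e \<in> E" for e
    using that finite_graph_E by (auto simp: finite_graph_def intro: card_ge_0_finite)
  have "card W \<le> (\<Sum>e\<in>?D. card e)" unfolding W_def by (rule card_Union_le_sum_card) 
  also have "\<dots> = 2 * card ?D" using two by simp
  finally have "card W < N" using * by linarith
  moreover have "finite W" unfolding W_def using fin two by auto
  ultimately have d: "card (dirty W) < N" using card_dirty le_less_trans by blast
  obtain a where a: "a \<in> {p + N + 2 + 2 * t..<J3}" "a \<notin> dirty W"
    by (rule clean_in_run[of W "{p + N + 2 + 2 * t..<J3}"]) (use d in \<open>auto simp: index_defs\<close>)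
  obtain b where b: "b \<in> {J3<..<Len}" "b \<notin> dirty W"
    by (rule clean_in_run[of W "{J3<..<Len}"]) (use d in \<open>auto simp: index_defs\<close>)
  obtain h where h: "h \<in> {p<..p + N}" "h \<notin> dirty W"
    by (rule clean_in_run[of W "{p<..p + N}"]) (use d in \<open>auto simp: index_defs\<close>)
  have W: "e \<subseteq> W" if "e \<in> E" "e \<notin> M1" "e \<notin> M2" "e \<notin> M3" for e using that by (auto simp: W_def)
  have odd: "rail_odd X h" if X: "perfect_matching V E X" "colours c W" "\<And>e. e \<in> E \<Longrightarrow> c e = 0 \<longleftrightarrow> e \<in> X" for X c
  proof -
    have "\<not> rail_odd X a" "\<not> rail_odd X b"
      using clean_Iso_rail_odd[OF X(2), of _ X] X(3) a b rty_run3[of a] rty_run4[of b] by (auto simp: Len_def)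
    then show ?thesis using forced_odd[OF X(1), of a b h] a b h by auto
  qed
  \<comment> \<open>Listing each matching first in turn makes it colour class 0, as
    \<open>odd\<close> requires.\<close>
  have "rail_odd M1 h" by (rule odd[OF M(1) matchings_colouring(1)[OF M(1,2,3)]]) (use W in auto)
  have "rail_odd M2 h" by (rule odd[OF M(2) matchings_colouring(1)[OF M(2,1,3)]]) (use W in auto)
  have "rail_odd M3 h" by (rule odd[OF M(3) matchings_colouring(1)[OF M(3,1,2)]]) (use W in auto)
  have hL: "h < Len" "rty h = Het" using h rty_run2 by (auto simp: index_defs)
  have disj: "e \<in> M1 \<longrightarrow> e \<notin> M2" "e \<in> M1 \<longrightarrow> e \<notin> M3" "e \<in> M2 \<longrightarrow> e \<notin> M3"
    if "v \<in> V - W" "e \<in> E" "v \<in> e" for v e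
    using matchings_colouring(2)[OF M(1,2,3) W that] matchings_colouring(2)[OF M(1,3,2) W that]
      matchings_colouring(2)[OF M(2,3,1) W that] by simp_all
  have "ends (Rail h j) \<in> M1 \<longrightarrow> ends (Rail h j) \<notin> M2"
      "ends (Rail h j) \<in> M1 \<longrightarrow> ends (Rail h j) \<notin> M3" "ends (Rail h j) \<in> M2 \<longrightarrow> ends (Rail h j) \<notin> M3"
    if "j < 2" for j
  proof -
    let ?v = "vt h (rt (rty h) j)"
    have "?v \<in> V - W" using h hL(1) inc_Rgt[OF that, of "rty h"] by (auto simp: dirty_def)
    moreover have "ends (Rail h j) \<in> E" unfolding E_def using hL that by (intro imageI) simp
    moreover have "?v \<in> ends (Rail h j)" by simp
    ultimately show "ends (Rail h j) \<in> M1 \<longrightarrow> ends (Rail h j) \<notin> M2"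
      "ends (Rail h j) \<in> M1 \<longrightarrow> ends (Rail h j) \<notin> M3" "ends (Rail h j) \<in> M2 \<longrightarrow> ends (Rail h j) \<notin> M3"
      using disj by blast+
  qed
  from this[of 0] this[of 1] show False
    using \<open>rail_odd M1 h\<close> \<open>rail_odd M2 h\<close> \<open>rail_odd M3 h\<close> unfolding rail_odd_def by auto
qed


text \<open>For \<open>f\<close> colour 0 is a perfect matching and there are \<open>p + t + 1\<close> defects, all of them of value 0;
  for \<open>\<not> f\<close> the \<open>p\<close> defects along the first run are traded for one at each of its ends.\<close>

definition rails :: "bool \<Rightarrow> nat \<Rightarrow> nat \<times> nat" where
  "rails f i =
    (if i \<le> p then (0, if f then if odd i then 1 else 2 else 0)
     else if i \<le> p + N then (0, if odd p then 1 else 2)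
     else if i = J2 then (2, if even t then 2 else 1)
     else if i < J3 then if rty i = Iso then (0, 0) else (2, 1)
     else (1, 1))"

text \<open>Clean long Iso runs put the third spoke into the perfect matching, as in
  \<open>forced_odd\<close>; hence its colour is 0.\<close>

definition spoke :: "nat \<Rightarrow> nat" where
  "spoke z = (if z = 0 then 1 else if z = J2 then 2 else 0)"

definition defects :: "bool \<Rightarrow> nat set" where
  "defects f = (if f then {1..p} else {0, Suc p}) \<union> ((\<lambda>s. p + N + 4 + 2 * s) ` {..<t} \<union> {J3})"

lemma finite_defects: "finite (defects f)"
  by (simp add: defects_def)

lemma card_defects: "card (defects True) \<le> p + t + 1" "card (defects False) \<le> t + 3"
proof -
  have "card ((\<lambda>s. p + N + 4 + 2 * s) ` {..<t} \<union> {J3}) \<le> t + 1"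
    using card_Un_le[of "(\<lambda>s. p + N + 4 + 2 * s) ` {..<t}" "{J3}"]
      card_image_le[of "{..<t}" "\<lambda>s. p + N + 4 + 2 * s"] by simp
  moreover have "card {0, Suc p} \<le> 2" by simp
  ultimately show "card (defects True) \<le> p + t + 1" "card (defects False) \<le> t + 3"
    using card_Un_le[of "{1..p}" "(\<lambda>s. p + N + 4 + 2 * s) ` {..<t} \<union> {J3}"]
      card_Un_le[of "{0, Suc p}" "(\<lambda>s. p + N + 4 + 2 * s) ` {..<t} \<union> {J3}"]
    by (simp_all add: defects_def)
qed

text \<open>Capping the pair number at \<open>t\<close> treats the Iso run after the pairs as one
  more segment, whose type \<open>parity_block (t + t)\<close> is Iso.\<close>

lemma rty_middle:
  assumes "m < 2 * t + N"
  shows "rty (p + N + 2 + m) = parity_block (min (m div 2) t + t)"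
proof (cases "m < 2 * t")
  case True
  then have "m div 2 < t" by simp
  then have "rty (p + N + 2 + 2 * (m div 2) + m mod 2) = parity_block (m div 2 + t)"
    by (intro rty_segment) simp_all
  moreover have "p + N + 2 + 2 * (m div 2) + m mod 2 = p + N + 2 + m" by simp
  ultimately show ?thesis using \<open>m div 2 < t\<close> by (simp only: min.absorb1 less_imp_le)
next
  case False
  then have "t \<le> m div 2" by simp
  then show ?thesis using rty_run3[of "p + N + 2 + m"] False assms by (simp add: J3_def parity_block_def)
qed

lemma defects_middle:
  assumes "m < 2 * t + N"
  shows "p + N + 2 + m \<in> defects f \<longleftrightarrow> even m \<and> 2 \<le> m \<and> m \<le> 2 * t"
proof
  assume "p + N + 2 + m \<in> defects f"
  then have "p + N + 2 + m \<in> (\<lambda>s. p + N + 4 + 2 * s) ` {..<t}"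
    using assms by (auto simp: defects_def J3_def split: if_splits)
  then obtain s where "s < t" "m = 2 * s + 2" by auto
  then show "even m \<and> 2 \<le> m \<and> m \<le> 2 * t" by simp
next
  assume m: "even m \<and> 2 \<le> m \<and> m \<le> 2 * t"
  then obtain k where "m = 2 * k" by blast
  then have "p + N + 2 + m = p + N + 4 + 2 * (k - 1)" "k - 1 < t" using m by auto
  then show "p + N + 2 + m \<in> defects f" unfolding defects_def by blast
qed

text \<open>The rail colours are determined by the type of the block on the left, so a defect is
  needed only in the first block after a change of type. The block at \<open>m = 0\<close> follows
  the second junction, whose right rails are coloured to suit the type
  \<open>parity_block t\<close>.\<close>

lemma extendable_middle:
  assumes m: "m < 2 * t + N" and i: "i = p + N + 2 + m"
  shows "extendable f (rty i) (rails f (prv i)) (rails f i) s (i \<in> defects f)"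
proof -
  have jn: "J2 < i" "i < J3" "\<not> i \<le> p" "\<not> i \<le> p + N" using m i by (auto simp: index_defs)
  have ri: "rails f i = (if rty i = Iso then (0, 0) else (2, 1))" using jn by (simp add: rails_def)
  have d: "i \<in> defects f \<longleftrightarrow> even m \<and> 2 \<le> m \<and> m \<le> 2 * t" using defects_middle[OF m] i by simp
  show ?thesis
  proof (cases "m = 0")
    case True
    then have "prv i = J2" using i by (simp add: prv_pos J2_def)
    moreover have "rty i = parity_block t" using rty_middle[OF m] True i by simp
    moreover have "rails f J2 = (2, if even t then 2 else 1)" by (simp add: rails_def J2_def)
    ultimately show ?thesis
      using ri d True modes_Iso(3)[of s] modes_Het(3)[of s] extendable_weaken
      by (auto simp: parity_block_def)
  next
    case False
    have p: "prv i = p + N + 2 + (m - 1)" using i False by (simp add: prv_pos)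
    then have "\<not> prv i \<le> p" "\<not> prv i \<le> p + N" "prv i \<noteq> J2" "prv i < J3"
      using m unfolding J2_def J3_def by simp_all
    then have rp: "rails f (prv i) = (if rty (prv i) = Iso then (0, 0) else (2, 1))"
      by (simp add: rails_def)
    have t0: "rty i = parity_block (min (m div 2) t + t)"
      using rty_middle[OF m] i by simp
    have t1: "rty (prv i) = parity_block (min ((m - 1) div 2) t + t)"
      unfolding p using m by (intro rty_middle) simp
    show ?thesis
    proof (cases "i \<in> defects f")
      case True
      then obtain k where k: "m = 2 * k" using d by blast
      then obtain k' where "k = Suc k'" using d True by (cases k) auto
      then have "m div 2 = Suc k'" "(m - 1) div 2 = k'" "Suc k' \<le> t" using k d True by simp_all
      then have "min (m div 2) t = Suc k'" "min ((m - 1) div 2) t = k'" by simp_all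
      then have "rty i = parity_block (Suc k' + t)" "rty (prv i) = parity_block (k' + t)"
        using t0 t1 by (simp_all only:)
      then have "rty i = Iso \<and> rty (prv i) = Het \<or> rty i = Het \<and> rty (prv i) = Iso"
        unfolding parity_block_def by auto
      then show ?thesis
        using ri rp True modes_Iso(6)[of s] modes_Het(4)[of s] extendable_weaken by auto
    next
      case nd: False
      \<comment> \<open>For odd \<open>m\<close> the block and its predecessor form a pair; for even
        \<open>m\<close> both lie beyond the last change, where the cap makes the two numbers
        equal.\<close>
      then have "min ((m - 1) div 2) t = min (m div 2) t"
      proof (cases "even m")
        case True
        then have "2 * t < m" using nd d False by auto
        then show ?thesis by auto
      next
        case False
        then show ?thesis by (auto elim!: oddE)
      qed
      then have "rty (prv i) = rty i" using t0 t1 by simp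
      moreover have "rty i = Iso \<or> rty i = Het" using t0 by (simp add: parity_block_def)
      ultimately show ?thesis
        using ri rp nd modes_Iso(2)[of s] modes_Het(3)[of s] extendable_weaken by auto
    qed
  qed
qed

lemma extendable_all:
  assumes i: "i < Len" and par: "odd (p + t)"
  shows "extendable f (rty i) (rails f (prv i)) (rails f i) (spoke i) (i \<in> defects f)"
proof -
  note weak = extendable_weaken[where m = f]
  have before: "i \<notin> (\<lambda>s. p + N + 4 + 2 * s) ` {..<t} \<union> {J3}" if "i \<le> J2"
    using that by (auto simp: index_defs)
  consider "i = 0" | "0 < i" "i \<le> p" | "p < i" "i \<le> p + N" | "i = J2"
    | "J2 < i" "i < J3" | "i = J3" | "J3 < i" unfolding J2_def by linarith
  then show ?thesis
  proof cases
    case 1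
    have "Len - 1 = J3 + N" by (simp add: Len_def)
    then have "rails f (prv 0) = (1, 1)" unfolding prv_0 by (simp add: rails_def J2_def J3_def)
    moreover have "rails f 0 = (0, if f then 2 else 0)" by (simp add: rails_def)
    moreover have "0 \<in> defects f \<longleftrightarrow> \<not> f" using before 1 by (auto simp: defects_def)
    moreover have "rty 0 = Jn" by (simp add: ring_ty_def)
    ultimately show ?thesis using 1 modes_Jn(1,2) weak by (cases f) (simp_all add: spoke_def)
  next
    case 2
    have r: "rails f i = (0, if f then if odd i then 1 else 2 else 0)"
      "rails f (prv i) = (0, if f then if odd i then 2 else 1 else 0)"
      using 2 by (auto simp: rails_def prv_pos)
    moreover have "i \<in> defects f \<longleftrightarrow> f" using before 2 by (auto simp: defects_def J2_def)
    moreover have "rty i = Iso" using rty_run1 2 by simp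
    ultimately show ?thesis using modes_Iso(2,4,5) weak by (cases f; cases "odd i") simp_all
  next
    case 3
    let ?x = "if odd p then 1 else 2 :: nat"
    have "rails f i = (0, ?x)" "rty i = Het" using 3 rty_run2 by (auto simp: rails_def)
    moreover have "rails f (prv i) = (0, if i = Suc p \<and> \<not> f then 0 else ?x)"
      using 3 by (cases "i = Suc p") (auto simp: rails_def prv_pos)
    moreover have "i \<in> defects f \<longleftrightarrow> i = Suc p \<and> \<not> f" using before 3 by (auto simp: defects_def J2_def)
    ultimately show ?thesis
      using modes_Het(1,2,5,6) weak by (cases "i = Suc p \<and> \<not> f"; cases "odd p") auto
  next
    case 4
    have "rails f (prv i) = (0, if odd p then 1 else 2)" using N_ge 4 by (simp add: rails_def prv_pos J2_def)
    moreover have "rails f i = (2, if even t then 2 else 1)" "spoke i = 2" "rty i = Jn"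
      using 4 rty_Jn[of J2] i by (simp_all add: rails_def J2_def spoke_def)
    moreover have "i \<notin> defects f" using before 4 N_ge by (auto simp: defects_def J2_def)
    \<comment> \<open>Here the parity condition enters: the colours that leave the Het run depend on
      \<open>p\<close>, those wanted after the junction depend on \<open>t\<close>, and the two
      junction modes match them only in this combination.\<close>
    moreover have "odd p \<longleftrightarrow> even t" using par by simp
    ultimately show ?thesis using modes_Jn(3,4) weak by (cases "even t") simp_all
  next
    case 5
    then show ?thesis
      using extendable_middle[of "i - (p + N + 2)" i f] by (simp add: index_defs)
  next
    case 6
    have "rty (J3 - 1) = Iso" using rty_run3[of "J3 - 1"] N_ge by (simp add: J3_def)
    moreover have "prv i = J3 - 1" using 6 by (simp add: prv_pos J3_def)
    moreover have "\<not> J3 - 1 \<le> p" "\<not> J3 - 1 \<le> p + N" "J3 - 1 \<noteq> J2" "J3 - 1 < J3"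
      using N_ge unfolding J2_def J3_def by simp_all
    ultimately have "rails f (prv i) = (0, 0)" by (simp add: rails_def)
    moreover have "rails f i = (1, 1)" "spoke i = 0" "rty i = Jn" "i \<in> defects f"
      using 6 rty_Jn[of J3] i by (simp_all add: rails_def index_defs spoke_def defects_def)
    ultimately show ?thesis using modes_Jn(5) weak by simp
  next
    case 7
    then have "prv i = i - 1" by (simp add: prv_pos)
    then have "rails f (prv i) = (1, 1)" "rails f i = (1, 1)" "i \<notin> defects f"
      using 7 unfolding rails_def defects_def J2_def J3_def by auto
    moreover have "rty i = Iso" using 7 rty_run4 by simp
    ultimately show ?thesis using modes_Iso(1) weak by simp
  qed
qed

lemma spokes: "distinct [spoke 0, spoke J2, spoke J3]" "0 \<in> {spoke 0, spoke J2, spoke J3}"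
  by (simp_all add: spoke_def index_defs)

lemma ring_snark:
  assumes "odd (p + t)" "p + t + 1 \<le> N"
  shows "nontrivial_snark V E" "resistance V E = t + 3" "oddness V E = p + t + 1"
    "N \<le> 2 * colouring_defect V E"
proof -
  have ext: "\<And>i. i < Len \<Longrightarrow> extendable f (rty i) (rails f (prv i)) (rails f i) (spoke i) (i \<in> defects f)" for f
    using extendable_all assms(1) by blast
  show r: "resistance V E = t + 3"
    using resistance_upper[OF ext finite_defects spokes(1)] card_defects(2) resistance_ge_t
    by (meson le_antisym le_trans)
  have upper: "oddness V E \<le> card (defects True)" "\<exists>F. two_factor V E F" "\<exists>M. perfect_matching V E M"
    by (rule oddness_upper[OF _ finite_defects spokes], rule ext, assumption)+
  have "p + t + 1 \<le> oddness V E"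
    by (rule oddness_lower[OF upper(2)]) (rule oddness_bound[OF _ _ _ _ assms(2)])
  then show "oddness V E = p + t + 1"
    using upper(1) card_defects(1) by (meson le_antisym le_trans)
  show "N \<le> 2 * colouring_defect V E"
  proof -
    let ?P = "\<lambda>k. \<exists>M1 M2 M3. perfect_matching V E M1 \<and> perfect_matching V E M2 \<and>
      perfect_matching V E M3 \<and> card (E - (M1 \<union> M2 \<union> M3)) = k"
    have "?P (colouring_defect V E)"
      unfolding colouring_defect_def by (rule LeastI_ex) (use upper(3) in blast)
    then show ?thesis using defect_bound by metis
  qed
  have "\<not> edge_colourable 3 E"
  proof
    assume "edge_colourable 3 E"
    then have "resistance V E \<le> 0"
      unfolding resistance_def by (intro Least_le exI[of _ "{}"]) simp
    then show False using r by simp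
  qed
  then show "nontrivial_snark V E"
    using finite_graph_E cubic_E bridgeless_E girth_ge_5 cyclically_4_edge_connected
    by (simp add: nontrivial_snark_def snark_def)
qed

end

theorem theorem1:
  fixes r \<omega> d :: nat
  assumes "r \<ge> 3" and "even \<omega>" and "\<omega> \<ge> r" and "real d \<ge> 3 / 2 * real \<omega>"
  shows "\<exists>(V :: nat set) E. nontrivial_snark V E \<and> resistance V E = r \<and>
           oddness V E = \<omega> \<and> colouring_defect V E \<ge> d"
proof -
  \<comment> \<open>The equations \<open>t + 3 = r\<close> and \<open>p + t + 1 = \<omega>\<close>
    determine \<open>t\<close> and \<open>p\<close>; the bounds on \<open>r\<close> and
    \<open>\<omega>\<close> make the subtractions exact. \<open>N\<close> exceeds
    \<open>\<omega>\<close>, for the oddness, and \<open>2 * d\<close>, to survive the halving in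
    the bound on the colouring defect.\<close>
  define p t N where "p = \<omega> - r + 2" and "t = r - 3" and "N = \<omega> + 2 * d + 2"
  interpret snark_ring p N t
    by unfold_locales (simp_all add: p_def N_def)
  have eq: "p + t + 1 = \<omega>" "t + 3 = r" using assms(1,3) by (simp_all add: p_def t_def)
  then have "odd (p + t)" "p + t + 1 \<le> N" using assms(2) by (auto simp: N_def)
  from ring_snark[OF this] show ?thesis
    using eq by (intro exI[of _ V] exI[of _ E]) (simp add: N_def)
qed

end
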